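(* Let $K_0,K_1\in\mathcal L(\mathbb R^p,\mathbb R^m)$ and $L_K=-BK_1C$. Assume that 1. the compatibility condition $A_1=BK_0C$ holds; 2. for each $N\ge1$, $\Pi_N$ and $\mu_{c,N}>0$ satisfy the critical quadratic inequality $$\Pi_NG_{cc,N}(d)+G_{cc,N}(d)^*\Pi_N\le-2\mu_{c,N}\Pi_N,\qquad\forall d\in[d_-,d_+],$$ with $\Pi_N$ self-adjoint positive definite on $X_{c,N}$, $\mu_{s,N}>0$, and for some integer $N_0\ge1$, $$\inf_{N\ge N_0}\mu_{c,N}=\underline\mu_c>0,\qquad \sup_{N\ge N_0}\|\Pi_N\|<\infty,\qquad\sup_{N\ge N_0}\|\Pi_N^{-1}\|<\infty.$$ Then there exists a truncation order $N^\star\ge1$ such that for every $N\ge N^\star$ the hypotheses of the uniform stability certificate hold, i.e. $\mu_{s,N}>0$, the critical quadratic inequality above holds, and there exists $\eta>0$ with $4\eta\mu_{c,N}\mu_{s,N}>(\gamma_{cs,N}+\eta\gamma_{sc,N})^2$. Consequently, the evolution equation $$\dot z+d(t)A_0z+L_Kz=0$$ is uniformly exponentially stable: there exist constants $M\ge1$ and $\omega>0$, independent of the admissible trajectory $d(\cdot):[0,\infty)\to[d_-,d_+]$, such that every solution satisfies $$\|z(t)\|_X\le Me^{-\omega(t-s)}\|z(s)\|_X,\qquad0\le s\le t.$$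
   Context: $X$ is a Hilbert space; $A_1\in\mathcal L(X)$, $B\in\mathcal L(\mathbb R^m,X)$, $C\in\mathcal L(X,\mathbb R^p)$. Constants $0<d_-\le d_+<\infty$ are fixed, and an admissible trajectory is a measurable function $d(\cdot):[0,\infty)\to[d_-,d_+]$. $A_0:D(A_0)\subset X\to X$ is densely defined, self-adjoint, strictly positive, with compact resolvent, so there is an orthonormal basis $\{\phi_j\}_{j\ge1}$ of $X$ with $A_0\phi_j=\lambda_j\phi_j$, $0<\lambda_1\le\lambda_2\le\cdots$, $\lambda_j\to+\infty$. For $N\ge1$: $X_{c,N}:=\operatorname{span}\{\phi_1,\dots,\phi_N\}$, $X_{s,N}:=X_{c,N}^\perp$, $P_N$ is the orthogonal projection onto $X_{c,N}$ and $Q_N:=I-P_N$. $G_{cc,N}(d):=-dA_0|_{X_{c,N}}-P_NL_KP_N$ on $X_{c,N}$. $\ell_{s,N}:=\sup_{x_s\in X_{s,N},\ \|x_s\|_X=1}\operatorname{Re}\langle-Q_NL_KQ_Nx_s,x_s\rangle_X$ and $\mu_{s,N}:=d_-\lambda_{N+1}-\ell_{s,N}$. $\gamma_{cs,N}:=\|\Pi_N^{1/2}P_NL_KQ_N\|_{\mathcal L(X_{s,N},X_{c,N})}$, $\gamma_{sc,N}:=\|Q_NL_KP_N\Pi_N^{-1/2}\|_{\mathcal L(X_{c,N},X_{s,N})}$. Solutions are strong solutions and, more generally, mild solutions given by the associated evolution family. *)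

theory Defs
  imports "HOL-Analysis.Analysis"
begin

text \<open>
  The control and observation operators act between \<open>X\<close> and the real spaces \<open>\<real>\<^sup>m\<close>, \<open>\<real>\<^sup>p\<close>, so the
  Hilbert space \<open>X\<close> is a real one (a type of sort \<open>{real_inner, complete_space}\<close>) and the real part of
  the inner product is the inner product itself.

  An operator on a subspace \<open>S\<close> is a total function of which only the values on \<open>S\<close> matter.
  Families indexed by \<open>j \<ge> 1\<close> are functions on \<open>nat\<close> whose value at \<open>0\<close> is never used.
\<close>

section \<open>Operators on subspaces\<close>

definition linear_on_sub :: "'a::real_vector set \<Rightarrow> ('a \<Rightarrow> 'b::real_vector) \<Rightarrow> bool" where
  "linear_on_sub S T \<longleftrightarrow> subspace S \<and>
     (\<forall>x\<in>S. \<forall>y\<in>S. T (x + y) = T x + T y) \<and> (\<forall>c. \<forall>x\<in>S. T (c *\<^sub>R x) = c *\<^sub>R T x)"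

text \<open>Same shape as \<^const>\<open>onorm\<close>; the point \<open>x = 0\<close> contributes \<open>0 / 0 = 0\<close>.\<close>

definition opnorm_on :: "'a::real_normed_vector set \<Rightarrow> ('a \<Rightarrow> 'b::real_normed_vector) \<Rightarrow> real" where
  "opnorm_on S T = (SUP x\<in>S. norm (T x) / norm x)"

definition selfadj_on :: "'a::real_inner set \<Rightarrow> ('a \<Rightarrow> 'a) \<Rightarrow> bool" where
  "selfadj_on S T \<longleftrightarrow> linear_on_sub S T \<and> T ` S \<subseteq> S \<and> (\<forall>x\<in>S. \<forall>y\<in>S. T x \<bullet> y = x \<bullet> T y)"

definition posdef_on :: "'a::real_inner set \<Rightarrow> ('a \<Rightarrow> 'a) \<Rightarrow> bool" where
  "posdef_on S T \<longleftrightarrow> selfadj_on S T \<and> (\<forall>x\<in>S. x \<noteq> 0 \<longrightarrow> 0 < T x \<bullet> x)"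

definition adj_on :: "'a::real_inner set \<Rightarrow> ('a \<Rightarrow> 'a) \<Rightarrow> 'a \<Rightarrow> 'a" where
  "adj_on S T = (SOME T'. T' ` S \<subseteq> S \<and> (\<forall>x\<in>S. \<forall>y\<in>S. T x \<bullet> y = x \<bullet> T' y))"

definition op_le_on :: "'a::real_inner set \<Rightarrow> ('a \<Rightarrow> 'a) \<Rightarrow> ('a \<Rightarrow> 'a) \<Rightarrow> bool" where
  "op_le_on S T T' \<longleftrightarrow> (\<forall>x\<in>S. T x \<bullet> x \<le> T' x \<bullet> x)"

text \<open>
  The positive square root; it is unique on \<open>S\<close> when \<open>T\<close> is positive definite and \<open>S\<close> has finite
  dimension, so that the choice is immaterial there.
\<close>

definition sqrt_on :: "'a::real_inner set \<Rightarrow> ('a \<Rightarrow> 'a) \<Rightarrow> 'a \<Rightarrow> 'a" where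
  "sqrt_on S T = (SOME R. posdef_on S R \<and> (\<forall>x\<in>S. R (R x) = T x))"

definition orth_proj :: "'a::real_inner set \<Rightarrow> 'a \<Rightarrow> 'a" where
  "orth_proj S x = (THE y. y \<in> S \<and> x - y \<in> S\<^sup>\<bottom>)"

section \<open>Unbounded operators\<close>

text \<open>The last conjunct says that the graphs of \<open>A\<close> (with domain \<open>D\<close>) and of its adjoint coincide.\<close>

definition selfadj_unbounded :: "'a::real_inner set \<Rightarrow> ('a \<Rightarrow> 'a) \<Rightarrow> bool" where
  "selfadj_unbounded D A \<longleftrightarrow> linear_on_sub D A \<and> closure D = UNIV \<and>
     (\<forall>y w. (\<forall>x\<in>D. A x \<bullet> y = x \<bullet> w) \<longleftrightarrow> (y \<in> D \<and> w = A y))"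

definition strictly_positive :: "'a::real_inner set \<Rightarrow> ('a \<Rightarrow> 'a) \<Rightarrow> bool" where
  "strictly_positive D A \<longleftrightarrow> (\<exists>m>0. \<forall>x\<in>D. m * (norm x)\<^sup>2 \<le> A x \<bullet> x)"

definition compact_operator :: "('a::real_normed_vector \<Rightarrow> 'b::real_normed_vector) \<Rightarrow> bool" where
  "compact_operator T \<longleftrightarrow> linear T \<and> compact (closure (T ` cball 0 1))"

definition compact_resolvent :: "'a::real_normed_vector set \<Rightarrow> ('a \<Rightarrow> 'a) \<Rightarrow> bool" where
  "compact_resolvent D A \<longleftrightarrow>
     (\<exists>\<zeta>::real. bij_betw (\<lambda>x. \<zeta> *\<^sub>R x - A x) D UNIV \<and>
        compact_operator (inv_into D (\<lambda>x. \<zeta> *\<^sub>R x - A x)))"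

definition orthonormal_basis :: "(nat \<Rightarrow> 'a::real_inner) \<Rightarrow> bool" where
  "orthonormal_basis \<phi> \<longleftrightarrow>
     (\<forall>i\<ge>1. \<forall>j\<ge>1. \<phi> i \<bullet> \<phi> j = (if i = j then 1 else 0)) \<and> closure (span (\<phi> ` {1..})) = UNIV"

definition eigenbasis :: "'a::real_inner set \<Rightarrow> ('a \<Rightarrow> 'a) \<Rightarrow> (nat \<Rightarrow> 'a) \<Rightarrow> (nat \<Rightarrow> real) \<Rightarrow> bool" where
  "eigenbasis D A \<phi> lam \<longleftrightarrow> orthonormal_basis \<phi> \<and>
     (\<forall>j\<ge>1. \<phi> j \<in> D \<and> A (\<phi> j) = lam j *\<^sub>R \<phi> j) \<and>
     0 < lam 1 \<and> (\<forall>j\<ge>1. lam j \<le> lam (Suc j)) \<and> filterlim lam at_top sequentially"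

section \<open>Spectral truncation\<close>

definition Xc :: "(nat \<Rightarrow> 'a::real_inner) \<Rightarrow> nat \<Rightarrow> 'a set" where
  "Xc \<phi> N = span (\<phi> ` {1..N})"

definition Xs :: "(nat \<Rightarrow> 'a::real_inner) \<Rightarrow> nat \<Rightarrow> 'a set" where
  "Xs \<phi> N = (Xc \<phi> N)\<^sup>\<bottom>"

definition Pr :: "(nat \<Rightarrow> 'a::real_inner) \<Rightarrow> nat \<Rightarrow> 'a \<Rightarrow> 'a" where
  "Pr \<phi> N = orth_proj (Xc \<phi> N)"

definition Qr :: "(nat \<Rightarrow> 'a::real_inner) \<Rightarrow> nat \<Rightarrow> 'a \<Rightarrow> 'a" where
  "Qr \<phi> N x = x - Pr \<phi> N x"

definition Gcc :: "('a \<Rightarrow> 'a) \<Rightarrow> (nat \<Rightarrow> 'a::real_inner) \<Rightarrow> ('a \<Rightarrow>\<^sub>L 'a) \<Rightarrow> nat \<Rightarrow> real \<Rightarrow> 'a \<Rightarrow> 'a" where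
  "Gcc A \<phi> L N d x = - (d *\<^sub>R A x) - Pr \<phi> N (L (Pr \<phi> N x))"

definition critical_inequality ::
  "('a \<Rightarrow> 'a) \<Rightarrow> (nat \<Rightarrow> 'a::real_inner) \<Rightarrow> ('a \<Rightarrow>\<^sub>L 'a) \<Rightarrow> real \<Rightarrow> real \<Rightarrow> nat \<Rightarrow> ('a \<Rightarrow> 'a) \<Rightarrow> real \<Rightarrow> bool"
  where
  "critical_inequality A \<phi> L dm dp N Pim \<mu> \<longleftrightarrow>
     (\<forall>d\<in>{dm..dp}. op_le_on (Xc \<phi> N)
        (\<lambda>x. Pim (Gcc A \<phi> L N d x) + adj_on (Xc \<phi> N) (Gcc A \<phi> L N d) (Pim x))
        (\<lambda>x. - (2 * \<mu>) *\<^sub>R Pim x))"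

definition ell_s :: "(nat \<Rightarrow> 'a::real_inner) \<Rightarrow> ('a \<Rightarrow>\<^sub>L 'a) \<Rightarrow> nat \<Rightarrow> real" where
  "ell_s \<phi> L N = (SUP x\<in>{x \<in> Xs \<phi> N. norm x = 1}. (- Qr \<phi> N (L (Qr \<phi> N x))) \<bullet> x)"

definition mu_s :: "(nat \<Rightarrow> 'a::real_inner) \<Rightarrow> (nat \<Rightarrow> real) \<Rightarrow> ('a \<Rightarrow>\<^sub>L 'a) \<Rightarrow> real \<Rightarrow> nat \<Rightarrow> real" where
  "mu_s \<phi> lam L dm N = dm * lam (N + 1) - ell_s \<phi> L N"

definition gamma_cs :: "(nat \<Rightarrow> 'a::real_inner) \<Rightarrow> ('a \<Rightarrow>\<^sub>L 'a) \<Rightarrow> nat \<Rightarrow> ('a \<Rightarrow> 'a) \<Rightarrow> real" where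
  "gamma_cs \<phi> L N Pim =
     opnorm_on (Xs \<phi> N) (\<lambda>x. sqrt_on (Xc \<phi> N) Pim (Pr \<phi> N (L (Qr \<phi> N x))))"

definition gamma_sc :: "(nat \<Rightarrow> 'a::real_inner) \<Rightarrow> ('a \<Rightarrow>\<^sub>L 'a) \<Rightarrow> nat \<Rightarrow> ('a \<Rightarrow> 'a) \<Rightarrow> real" where
  "gamma_sc \<phi> L N Pim =
     opnorm_on (Xc \<phi> N)
       (\<lambda>x. Qr \<phi> N (L (Pr \<phi> N (inv_into (Xc \<phi> N) (sqrt_on (Xc \<phi> N) Pim) x))))"

section \<open>Solutions of \<open>z' + d(t) A z + L z = 0\<close>\<close>

definition admissible :: "real \<Rightarrow> real \<Rightarrow> (real \<Rightarrow> real) \<Rightarrow> bool" where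
  "admissible dm dp d \<longleftrightarrow> d \<in> borel_measurable (lebesgue_on {0..}) \<and> (\<forall>t\<ge>0. d t \<in> {dm..dp})"

definition abs_continuous_on :: "real \<Rightarrow> real \<Rightarrow> (real \<Rightarrow> 'a::real_normed_vector) \<Rightarrow> bool" where
  "abs_continuous_on a b f \<longleftrightarrow>
     (\<forall>\<epsilon>>0. \<exists>\<delta>>0. \<forall>(n::nat) u v.
        (\<forall>i<n. a \<le> u i \<and> u i \<le> v i \<and> v i \<le> b) \<and>
        disjoint_family_on (\<lambda>i. {u i<..<v i}) {..<n} \<and> (\<Sum>i<n. v i - u i) < \<delta> \<longrightarrow>
        (\<Sum>i<n. norm (f (v i) - f (u i))) < \<epsilon>)"

text \<open>
  Strong solutions on \<open>[t0, \<infinity>)\<close>. Absolute continuity is required only on compact subintervals of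
  \<open>(t0, \<infinity>)\<close>, so initial values outside the domain of \<open>A\<close> are allowed.
\<close>

definition strong_solution ::
  "'a::real_inner set \<Rightarrow> ('a \<Rightarrow> 'a) \<Rightarrow> ('a \<Rightarrow>\<^sub>L 'a) \<Rightarrow> (real \<Rightarrow> real) \<Rightarrow> real \<Rightarrow> (real \<Rightarrow> 'a) \<Rightarrow> bool" where
  "strong_solution D A L d t0 z \<longleftrightarrow> continuous_on {t0..} z \<and>
     (\<forall>a b. t0 < a \<and> a \<le> b \<longrightarrow> abs_continuous_on a b z) \<and>
     (AE t in lebesgue. t0 < t \<longrightarrow>
        z t \<in> D \<and> (z has_vector_derivative (- (d t *\<^sub>R A (z t)) - L (z t))) (at t))"

text \<open>
  The semigroup \<open>e\<^bsup>-\<tau>A\<^esup>\<close> for \<open>A (\<phi> j) = lam j *\<^sub>R \<phi> j\<close>, and the evolution family \<open>S(t,s)\<close> that \<open>-d(t)A\<close>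
  generates: the operators \<open>d(t)A\<close> commute, so \<open>S(t,s)\<close> is the semigroup at time \<open>\<integral>\<^sub>s\<^sup>t d\<close>.
\<close>

definition diag_semigroup :: "(nat \<Rightarrow> 'a::real_inner) \<Rightarrow> (nat \<Rightarrow> real) \<Rightarrow> real \<Rightarrow> 'a \<Rightarrow> 'a" where
  "diag_semigroup \<phi> lam \<tau> x = (\<Sum>j. (exp (- \<tau> * lam (Suc j)) * (x \<bullet> \<phi> (Suc j))) *\<^sub>R \<phi> (Suc j))"

definition diag_evolution ::
  "(nat \<Rightarrow> 'a::real_inner) \<Rightarrow> (nat \<Rightarrow> real) \<Rightarrow> (real \<Rightarrow> real) \<Rightarrow> real \<Rightarrow> real \<Rightarrow> 'a \<Rightarrow> 'a" where
  "diag_evolution \<phi> lam d t s = diag_semigroup \<phi> lam (integral {s..t} d)"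

text \<open>
  \<open>U\<close> is the evolution family of \<open>-d(t)A - L\<close>: a strongly continuous evolution family of bounded
  operators with \<open>U(t,s)x = S(t,s)x - \<integral>\<^sub>s\<^sup>t S(t,r) L U(r,s)x dr\<close>. The integrand is continuous in \<open>r\<close>.
\<close>

definition evolution_family ::
  "(nat \<Rightarrow> 'a::real_inner) \<Rightarrow> (nat \<Rightarrow> real) \<Rightarrow> ('a \<Rightarrow>\<^sub>L 'a) \<Rightarrow> (real \<Rightarrow> real) \<Rightarrow>
     (real \<Rightarrow> real \<Rightarrow> 'a \<Rightarrow> 'a) \<Rightarrow> bool" where
  "evolution_family \<phi> lam L d U \<longleftrightarrow>
     (\<forall>s t. 0 \<le> s \<and> s \<le> t \<longrightarrow> bounded_linear (U t s)) \<and>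
     (\<forall>s\<ge>0. \<forall>x. U s s x = x) \<and>
     (\<forall>s r t x. 0 \<le> s \<and> s \<le> r \<and> r \<le> t \<longrightarrow> U t r (U r s x) = U t s x) \<and>
     (\<forall>x. continuous_on {(t, s). 0 \<le> s \<and> s \<le> t} (\<lambda>(t, s). U t s x)) \<and>
     (\<forall>s t x. 0 \<le> s \<and> s \<le> t \<longrightarrow>
        ((\<lambda>r. diag_evolution \<phi> lam d t r (L (U r s x)))
           has_integral (diag_evolution \<phi> lam d t s x - U t s x)) {s..t})"

definition mild_solution ::
  "(nat \<Rightarrow> 'a::real_inner) \<Rightarrow> (nat \<Rightarrow> real) \<Rightarrow> ('a \<Rightarrow>\<^sub>L 'a) \<Rightarrow> (real \<Rightarrow> real) \<Rightarrow> real \<Rightarrow> (real \<Rightarrow> 'a) \<Rightarrow> bool"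
  where
  "mild_solution \<phi> lam L d t0 z \<longleftrightarrow>
     (\<exists>U. evolution_family \<phi> lam L d U \<and> (\<forall>t\<ge>t0. z t = U t t0 (z t0)))"

text \<open>Solutions may start at any \<open>t0 \<ge> 0\<close>; \<open>t0 = 0\<close> gives the solutions on \<open>[0, \<infinity>)\<close>.\<close>

definition uniformly_exp_stable ::
  "'a::real_inner set \<Rightarrow> ('a \<Rightarrow> 'a) \<Rightarrow> (nat \<Rightarrow> 'a) \<Rightarrow> (nat \<Rightarrow> real) \<Rightarrow> ('a \<Rightarrow>\<^sub>L 'a) \<Rightarrow> real \<Rightarrow> real \<Rightarrow> bool"
  where
  "uniformly_exp_stable D A \<phi> lam L dm dp \<longleftrightarrow>
     (\<exists>M\<ge>1. \<exists>\<omega>>0. \<forall>d. admissible dm dp d \<longrightarrow>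
        (\<forall>t0\<ge>0. \<forall>z. strong_solution D A L d t0 z \<or> mild_solution \<phi> lam L d t0 z \<longrightarrow>
           (\<forall>s t. t0 \<le> s \<and> s \<le> t \<longrightarrow> norm (z t) \<le> M * exp (- \<omega> * (t - s)) * norm (z s))))"

end

theory Submission
  imports Defs
begin

text \<open>
  Passing to the coefficients \<open>z \<bullet> \<phi> j\<close> turns both strong and mild solutions into families of
  absolutely continuous scalar functions that satisfy the diagonalised equation almost everywhere. For
  a large truncation order the gap condition makes \<open>V(x) = \<langle>\<Pi> P\<^sub>N x, P\<^sub>N x\<rangle> + \<eta> \<parallel>Q\<^sub>N x\<parallel>\<^sup>2\<close> a strict
  Lyapunov function on every span of finitely many \<open>\<phi> j\<close>, uniformly in \<open>d\<close>, so \<open>V\<close> decays along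
  Galerkin truncations of a solution up to an error that vanishes in the limit. The gap condition
  holds for large \<open>N\<close> with \<open>\<eta> = 1\<close> because the coupling norms and \<open>\<mu>\<^sub>c\<^sub>,\<^sub>N\<close> stay controlled while
  \<open>\<mu>\<^sub>s\<^sub>,\<^sub>N\<close> tends to infinity with \<open>\<lambda>\<^sub>N\<^sub>+\<^sub>1\<close>.
\<close>

section \<open>Absolute continuity\<close>

text \<open>The obstacle is that \<open>V\<close> cannot be differentiated along the solution
  itself: a mild solution need not enter the domain of \<open>A\<close>, and the dissipation
  inequality involves the unbounded \<open>A\<close>. A truncation \<open>Pr \<phi> n (z t)\<close>
  does lie in the domain, but it solves the truncated equation only up to a defect governed by
  \<open>L (Qr \<phi> n (z t))\<close>, because \<open>L\<close> mixes the modes; compactness of the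
  trajectory over \<open>[a, b]\<close> makes this defect uniformly small. Since \<open>d\<close> is
  merely measurable, derivatives exist only almost everywhere, so decay has to come from a
  monotonicity theorem for absolutely continuous functions instead of the mean value theorem. Scalar
  coefficients reduce all differentiation of integrals to the real-valued case. Strong solutions are
  absolutely continuous only away from the initial time; the estimate is therefore proved from times
  \<open>a > t0\<close> and reaches \<open>t0\<close> by continuity.\<close>

lemma abs_continuous_on_mono_variation:
  fixes f :: "real \<Rightarrow> 'b::real_normed_vector" and w :: "real \<Rightarrow> 'c::real_normed_vector"
  assumes w: "abs_continuous_on a b w" and K: "0 \<le> K"
    and le: "\<And>u v. \<lbrakk>a \<le> u; u \<le> v; v \<le> b\<rbrakk> \<Longrightarrow> norm (f v - f u) \<le> K * ((v - u) + norm (w v - w u))"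
  shows "abs_continuous_on a b f"
  unfolding abs_continuous_on_def
proof (intro allI impI)
  fix e :: real assume e: "e > 0"
  \<comment> \<open>The lengths and the increments of \<open>w\<close> contribute at most
    \<open>K * e'\<close> each; \<open>K + 1\<close> in place of \<open>K\<close> keeps the quotient
    meaningful for \<open>K = 0\<close> and makes the final bound strict.\<close>
  define e' where "e' = e / (2 * (K + 1))"
  have e': "e' > 0" using e K by (simp add: e'_def)
  then obtain \<delta> where \<delta>: "\<delta> > 0" and *: "\<And>(n::nat) u v.
        (\<forall>i<n. a \<le> u i \<and> u i \<le> v i \<and> v i \<le> b) \<and>
        disjoint_family_on (\<lambda>i. {u i<..<v i}) {..<n} \<and> (\<Sum>i<n. v i - u i) < \<delta> \<Longrightarrow>
        (\<Sum>i<n. norm (w (v i) - w (u i))) < e'"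
    using w unfolding abs_continuous_on_def by blast
  show "\<exists>\<delta>>0. \<forall>(n::nat) u v.
        (\<forall>i<n. a \<le> u i \<and> u i \<le> v i \<and> v i \<le> b) \<and>
        disjoint_family_on (\<lambda>i. {u i<..<v i}) {..<n} \<and> (\<Sum>i<n. v i - u i) < \<delta> \<longrightarrow>
        (\<Sum>i<n. norm (f (v i) - f (u i))) < e"
  \<comment> \<open>\<open>\<delta>\<close> controls the increments of \<open>w\<close>, the second
    entry \<open>e'\<close> controls the total length.\<close>
  proof (intro exI[of _ "min \<delta> e'"] conjI allI impI)
    show "min \<delta> e' > 0" using \<delta> e' by simp
    fix n :: nat and u v :: "nat \<Rightarrow> real"
    assume A: "(\<forall>i<n. a \<le> u i \<and> u i \<le> v i \<and> v i \<le> b) \<and>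
        disjoint_family_on (\<lambda>i. {u i<..<v i}) {..<n} \<and> (\<Sum>i<n. v i - u i) < min \<delta> e'"
    have "(\<Sum>i<n. norm (f (v i) - f (u i))) \<le> (\<Sum>i<n. K * ((v i - u i) + norm (w (v i) - w (u i))))"
      using A by (intro sum_mono le) auto
    also have "\<dots> = K * ((\<Sum>i<n. v i - u i) + (\<Sum>i<n. norm (w (v i) - w (u i))))"
      by (simp only: sum_distrib_left[symmetric] sum.distrib)
    also have "\<dots> \<le> K * (e' + e')"
      using A *[of n u v] K by (intro mult_left_mono add_mono) auto
    also have "\<dots> < (K + 1) * (e' + e')" using e' by (intro mult_strict_right_mono) auto
    also have "\<dots> = e" using K by (simp add: e'_def divide_simps)
    finally show "(\<Sum>i<n. norm (f (v i) - f (u i))) < e" .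
  qed
qed

lemma abs_continuous_on_lipschitz:
  fixes f :: "real \<Rightarrow> 'b::real_normed_vector"
  assumes "0 \<le> K" and "\<And>u v. \<lbrakk>a \<le> u; u \<le> v; v \<le> b\<rbrakk> \<Longrightarrow> norm (f v - f u) \<le> K * (v - u)"
  shows "abs_continuous_on a b f"
proof (rule abs_continuous_on_mono_variation)
  show "abs_continuous_on a b (\<lambda>_. 0::real)" by (auto simp: abs_continuous_on_def)
qed (use assms in auto)

lemma abs_continuous_on_add:
  fixes f g :: "real \<Rightarrow> 'b::real_normed_vector"
  assumes f: "abs_continuous_on a b f" and g: "abs_continuous_on a b g"
  shows "abs_continuous_on a b (\<lambda>t. f t + g t)"
  unfolding abs_continuous_on_def
proof (intro allI impI)
  fix e :: real assume "e > 0"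
  then have e2: "e / 2 > 0" by simp
  obtain d1 where d1: "d1 > 0" "\<forall>(n::nat) u v.
        (\<forall>i<n. a \<le> u i \<and> u i \<le> v i \<and> v i \<le> b) \<and>
        disjoint_family_on (\<lambda>i. {u i<..<v i}) {..<n} \<and> (\<Sum>i<n. v i - u i) < d1 \<longrightarrow>
        (\<Sum>i<n. norm (f (v i) - f (u i))) < e / 2"
    using f e2 unfolding abs_continuous_on_def by meson
  obtain d2 where d2: "d2 > 0" "\<forall>(n::nat) u v.
        (\<forall>i<n. a \<le> u i \<and> u i \<le> v i \<and> v i \<le> b) \<and>
        disjoint_family_on (\<lambda>i. {u i<..<v i}) {..<n} \<and> (\<Sum>i<n. v i - u i) < d2 \<longrightarrow>
        (\<Sum>i<n. norm (g (v i) - g (u i))) < e / 2"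
    using g e2 unfolding abs_continuous_on_def by meson
  show "\<exists>\<delta>>0. \<forall>(n::nat) u v.
        (\<forall>i<n. a \<le> u i \<and> u i \<le> v i \<and> v i \<le> b) \<and>
        disjoint_family_on (\<lambda>i. {u i<..<v i}) {..<n} \<and> (\<Sum>i<n. v i - u i) < \<delta> \<longrightarrow>
        (\<Sum>i<n. norm (f (v i) + g (v i) - (f (u i) + g (u i)))) < e"
  proof (intro exI[of _ "min d1 d2"] conjI allI impI)
    show "min d1 d2 > 0" using d1(1) d2(1) by simp
    fix n :: nat and u v :: "nat \<Rightarrow> real"
    assume A: "(\<forall>i<n. a \<le> u i \<and> u i \<le> v i \<and> v i \<le> b) \<and>
        disjoint_family_on (\<lambda>i. {u i<..<v i}) {..<n} \<and> (\<Sum>i<n. v i - u i) < min d1 d2"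
    have "(\<Sum>i<n. norm (f (v i) + g (v i) - (f (u i) + g (u i))))
       \<le> (\<Sum>i<n. norm (f (v i) - f (u i)) + norm (g (v i) - g (u i)))"
      by (intro sum_mono norm_diff_triangle_ineq)
    also have "\<dots> = (\<Sum>i<n. norm (f (v i) - f (u i))) + (\<Sum>i<n. norm (g (v i) - g (u i)))"
      by (rule sum.distrib)
    also have "\<dots> < e / 2 + e / 2"
      using A by (intro add_strict_mono d1(2)[rule_format] d2(2)[rule_format]) auto
    finally show "(\<Sum>i<n. norm (f (v i) + g (v i) - (f (u i) + g (u i)))) < e" by simp
  qed
qed

lemma abs_continuous_on_sum:
  fixes f :: "'i \<Rightarrow> real \<Rightarrow> 'b::real_normed_vector"
  assumes "\<And>i. i \<in> I \<Longrightarrow> abs_continuous_on a b (f i)"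
  shows "abs_continuous_on a b (\<lambda>t. \<Sum>i\<in>I. f i t)"
  using assms
proof (induction I rule: infinite_finite_induct)
  case (insert i I)
  then show ?case by (simp add: abs_continuous_on_add)
qed (simp_all add: abs_continuous_on_lipschitz[of 0])

text \<open>The gauge argument below produces tagged partial divisions, while absolute continuity
  speaks of indexed open intervals. Enumerating the division is enough, because distinct cells have
  disjoint interiors and shared endpoints do no harm.\<close>

lemma abs_continuous_on_tagged_sum:
  fixes f :: "real \<Rightarrow> real"
  assumes ac: "\<forall>(n::nat) u v.
        (\<forall>i<n. a \<le> u i \<and> u i \<le> v i \<and> v i \<le> b) \<and>
        disjoint_family_on (\<lambda>i. {u i<..<v i}) {..<n} \<and> (\<Sum>i<n. v i - u i) < \<delta> \<longrightarrow>
        (\<Sum>i<n. norm (f (v i) - f (u i))) < e"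
    and p: "p tagged_partial_division_of {a..b}"
    and small: "(\<Sum>(x,K)\<in>p. measure lborel K) < \<delta>"
  shows "(\<Sum>(x,K)\<in>p. norm (f (Sup K) - f (Inf K))) < e"
proof -
  note pd = tagged_partial_division_ofD[OF p]
  obtain h n where h: "bij_betw h {..<n::nat} p"
    using ex_bij_betw_nat_finite[OF pd(1)] by (metis atLeast0LessThan)
  define u v where "u i = Inf (snd (h i))" and "v i = Sup (snd (h i))" for i
  have iv: "snd (h i) = {u i..v i} \<and> a \<le> u i \<and> u i \<le> v i \<and> v i \<le> b" if "i < n" for i
  proof -
    have hi: "(fst (h i), snd (h i)) \<in> p" using h that by (auto simp: bij_betw_def)
    obtain c d where cd: "snd (h i) = {c..d}" using pd(4)[OF hi] by auto
    have "c \<le> d" using pd(2)[OF hi] cd by auto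
    then show ?thesis using cd pd(3)[OF hi] by (auto simp: u_def v_def)
  qed
  have re: "(\<Sum>(x,K)\<in>p. g K) = (\<Sum>i<n. g (snd (h i)))" for g :: "real set \<Rightarrow> real"
    using sum.reindex_bij_betw[OF h, of "\<lambda>(x,K). g K"] by (simp add: split_def)
  have "(\<Sum>i<n. norm (f (v i) - f (u i))) < e"
  proof (rule ac[rule_format], intro conjI allI impI)
    show "disjoint_family_on (\<lambda>i. {u i<..<v i}) {..<n}"
      unfolding disjoint_family_on_def
    proof (intro ballI impI)
      fix i j assume ij: "i \<in> {..<n}" "j \<in> {..<n}" "i \<noteq> j"
      then have "h i \<noteq> h j" using h by (auto simp: bij_betw_def inj_on_def)
      moreover have "h i \<in> p" "h j \<in> p" using h ij by (auto simp: bij_betw_def)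
      ultimately have "interior (snd (h i)) \<inter> interior (snd (h j)) = {}"
        using pd(5)[of "fst (h i)" "snd (h i)" "fst (h j)" "snd (h j)"] by simp
      then show "{u i<..<v i} \<inter> {u j<..<v j} = {}" using iv ij by simp
    qed
    have "(\<Sum>i<n. v i - u i) = (\<Sum>(x,K)\<in>p. measure lborel K)"
      unfolding re using iv by (intro sum.cong) auto
    then show "(\<Sum>i<n. v i - u i) < \<delta>" using small by simp
  qed (use iv in auto)
  also have "(\<Sum>i<n. norm (f (v i) - f (u i))) = (\<Sum>(x,K)\<in>p. norm (f (Sup K) - f (Inf K)))"
    unfolding re by (simp add: u_def v_def)
  finally show ?thesis .
qed

text \<open>
  A fine tagged division whose tags in the exceptional set \<open>E\<close> carry intervals inside an open set of
  small measure: these contribute little by absolute continuity, the others by the derivative bound.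
\<close>

lemma abs_continuous_nonincreasing:
  fixes f :: "real \<Rightarrow> real"
  assumes ab: "a \<le> b" and ac: "abs_continuous_on a b f" and E: "negligible E"
    and der: "\<And>x. \<lbrakk>a < x; x < b; x \<notin> E\<rbrakk> \<Longrightarrow> \<exists>y\<le>0. (f has_real_derivative y) (at x)"
  shows "f b \<le> f a"
proof (rule field_le_epsilon)
  fix e0 :: real assume e0: "e0 > 0"
  \<comment> \<open>Cells tagged in the exceptional set cost \<open>e\<close> altogether, the
    remaining ones \<open>e * (b - a)\<close>; the total is \<open>e0\<close>.\<close>
  define e where "e = e0 / (b - a + 1)"
  have e: "e > 0" using e0 ab by (simp add: e_def)
  obtain \<delta> where \<delta>: "\<delta> > 0" and ac\<delta>: "\<forall>(n::nat) u v.
        (\<forall>i<n. a \<le> u i \<and> u i \<le> v i \<and> v i \<le> b) \<and>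
        disjoint_family_on (\<lambda>i. {u i<..<v i}) {..<n} \<and> (\<Sum>i<n. v i - u i) < \<delta> \<longrightarrow>
        (\<Sum>i<n. norm (f (v i) - f (u i))) < e"
    using ac e unfolding abs_continuous_on_def by meson
  \<comment> \<open>The derivative is given only in the open interval, so the endpoints join the
    exceptional set, which stays null.\<close>
  define E' where "E' = insert a (insert b E)"
  have "negligible E'" using E by (simp add: E'_def)
  then have E'0: "E' \<in> null_sets lebesgue" by (simp add: negligible_iff_null_sets)
  obtain T where T: "open T" "E' \<subseteq> T" "T - E' \<in> lmeasurable" "emeasure lebesgue (T - E') < ennreal \<delta>"
    using sets_lebesgue_outer_open[of E' \<delta>] E'0 \<delta> by (metis null_setsD2)
  have Tm: "T \<in> lmeasurable" "measure lebesgue T < \<delta>"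
  proof -
    have "emeasure lebesgue T \<le> emeasure lebesgue (T - E') + emeasure lebesgue E'"
      using T(1-3) E'0 by (intro order_trans[OF emeasure_mono emeasure_subadditive])
        (auto simp: fmeasurableD)
    then have lt: "emeasure lebesgue T < ennreal \<delta>" using T(4) E'0 by (simp add: null_setsD1)
    then show "T \<in> lmeasurable" using T(1) by (intro fmeasurableI) (auto simp: order_less_le_trans top.extremum_unique less_top)
    then show "measure lebesgue T < \<delta>" using lt \<delta> by (simp add: emeasure_eq_measure2 ennreal_less_iff)
  qed
  have "\<exists>r. r > 0 \<and> (x \<in> E' \<longrightarrow> ball x r \<subseteq> T) \<and>
     (x \<in> {a..b} - E' \<longrightarrow> (\<forall>u v. u \<le> x \<and> x \<le> v \<and> u \<in> ball x r \<and> v \<in> ball x r \<longrightarrow> f v - f u \<le> e * (v - u)))" for x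
  proof -
    consider "x \<in> E'" | "x \<in> {a..b} - E'" | "x \<notin> E'" "x \<notin> {a..b}" by auto
    then show ?thesis
    proof cases
      case 1
      then obtain r where "r > 0" "ball x r \<subseteq> T" using T(1,2) open_contains_ball by blast
      then show ?thesis using 1 by auto
    next
      case 2
      then obtain y where y: "y \<le> 0" "(f has_real_derivative y) (at x)"
        using der[of x] by (auto simp: E'_def)
      then have "(f has_derivative (\<lambda>h. y * h)) (at x)"
        by (simp add: has_field_derivative_def)
      then obtain r where r: "r > 0" and R: "\<And>z. norm (z - x) < r \<Longrightarrow> norm (f z - f x - y * (z - x)) \<le> e * norm (z - x)"
        using e unfolding has_derivative_at_alt by meson
      \<comment> \<open>Straddling: as \<open>u\<close> and \<open>v\<close> lie on opposite sides
        of \<open>x\<close>, the first-order errors \<open>e * (v - x)\<close> and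
        \<open>e * (x - u)\<close> add up to exactly \<open>e * (v - u)\<close>.\<close>
      have "f v - f u \<le> e * (v - u)" if "u \<le> x" "x \<le> v" "u \<in> ball x r" "v \<in> ball x r" for u v
      proof -
        have "\<bar>f v - f x - y * (v - x)\<bar> \<le> e * (v - x)"
          using R[of v] that by (simp add: dist_real_def abs_minus_commute)
        moreover have "\<bar>f u - f x - y * (u - x)\<bar> \<le> e * (x - u)"
          using R[of u] that by (simp add: dist_real_def abs_minus_commute)
        ultimately have "f v - f u \<le> y * (v - u) + e * (v - u)" by (simp add: algebra_simps abs_le_iff)
        moreover have "y * (v - u) \<le> 0" using y that by (intro mult_nonpos_nonneg) auto
        ultimately show ?thesis by linarith
      qed
      then show ?thesis using 2 r by auto
    qed (auto intro: exI[of _ 1])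
  qed
  then obtain r where r: "\<And>x. r x > 0" "\<And>x. x \<in> E' \<Longrightarrow> ball x (r x) \<subseteq> T"
    "\<And>x u v. \<lbrakk>x \<in> {a..b} - E'; u \<le> x; x \<le> v; u \<in> ball x (r x); v \<in> ball x (r x)\<rbrakk> \<Longrightarrow> f v - f u \<le> e * (v - u)"
    by metis
  have "gauge (\<lambda>x. ball x (r x))" using r(1) by (simp add: gauge_def)
  then obtain p where p: "p tagged_division_of {a..b}" "(\<lambda>x. ball x (r x)) fine p"
    by (rule fine_division_exists_real)
  note pd = tagged_division_ofD[OF p(1)]
  have fine: "K \<subseteq> ball x (r x)" if "(x, K) \<in> p" for x K using p(2) that by (auto simp: fine_def)
  define q1 where "q1 = {(x,K) \<in> p. x \<in> E'}"
  define q2 where "q2 = {(x,K) \<in> p. x \<notin> E'}"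
  have pq: "p = q1 \<union> q2" "q1 \<inter> q2 = {}" "q1 \<subseteq> p" "q2 \<subseteq> p" "finite q1" "finite q2"
    using pd(1) by (auto simp: q1_def q2_def intro: finite_subset)
  have IK: "\<exists>c d. K = {c..d} \<and> c \<le> x \<and> x \<le> d \<and> a \<le> c \<and> d \<le> b" if xK: "(x,K) \<in> p" for x K
  proof -
    obtain c d where cd: "K = {c..d}" using pd(4)[OF xK] by auto
    then show ?thesis using pd(2)[OF xK] pd(3)[OF xK] by auto
  qed
  have q1p: "q1 tagged_partial_division_of {a..b}"
    using p(1) pq(3) by (meson tagged_division_of_def tagged_partial_division_subset)
  \<comment> \<open>The cells do not overlap, so their total length is the measure of their union,
    and this union lies in the small open set \<open>T\<close>.\<close>
  have "(\<Sum>(x,K)\<in>q1. measure lborel K) = measure lebesgue (\<Union>(snd ` q1))"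
  proof -
    have "((\<lambda>_. 1::real) has_integral (\<Sum>(x,K)\<in>q1. measure lborel K)) (\<Union>(snd ` q1))"
    proof (rule has_integral_combine_tagged_division[OF tagged_partial_division_of_Union_self[OF q1p]])
      fix x K assume "(x, K) \<in> q1"
      then obtain c d where "K = {c..d}" using IK pq(3) by blast
      then show "((\<lambda>_. 1::real) has_integral measure lborel K) K"
        using has_integral_const_real[of "1::real" c d] by simp
    qed
    moreover have "\<Union>(snd ` q1) \<in> lmeasurable"
      using pq(5) IK pq(3) by (intro fmeasurable.finite_Union) fastforce+
    ultimately show ?thesis by (simp add: lmeasure_integral integral_unique)
  qed
  also have "\<dots> \<le> measure lebesgue T"
  proof (rule measure_mono_fmeasurable)
    show "\<Union>(snd ` q1) \<subseteq> T" using fine r(2) pq(3) by (fastforce simp: q1_def)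
    show "\<Union>(snd ` q1) \<in> sets lebesgue"
      using pq(5) IK pq(3) by (intro sets.finite_Union) fastforce+
  qed (use Tm in auto)
  also have "\<dots> < \<delta>" by (rule Tm)
  finally have "(\<Sum>(x,K)\<in>q1. norm (f (Sup K) - f (Inf K))) < e"
    by (rule abs_continuous_on_tagged_sum[OF ac\<delta> q1p])
  moreover have "(\<Sum>(x,K)\<in>q1. f (Sup K) - f (Inf K)) \<le> (\<Sum>(x,K)\<in>q1. norm (f (Sup K) - f (Inf K)))"
    by (rule sum_mono) auto
  ultimately have s1: "(\<Sum>(x,K)\<in>q1. f (Sup K) - f (Inf K)) \<le> e" by linarith
  have "(\<Sum>(x,K)\<in>q2. f (Sup K) - f (Inf K)) \<le> (\<Sum>(x,K)\<in>q2. e * measure lborel K)"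
  proof (rule sum_mono, clarify)
    fix x K assume xK: "(x, K) \<in> q2"
    then have xp: "(x,K) \<in> p" using pq by auto
    obtain c d where cd: "K = {c..d}" "c \<le> x" "x \<le> d" "a \<le> c" "d \<le> b" using IK[OF xp] by blast
    have "f d - f c \<le> e * (d - c)"
    proof (rule r(3)[of x c d])
      show "x \<in> {a..b} - E'" using cd xK by (auto simp: q2_def)
      have "c \<in> K" "d \<in> K" using cd by auto
      then show "c \<in> ball x (r x)" "d \<in> ball x (r x)" using fine[OF xp] by blast+
      show "c \<le> x" "x \<le> d" using cd by auto
    qed
    then show "f (Sup K) - f (Inf K) \<le> e * measure lborel K" using cd by simp
  qed
  also have "\<dots> \<le> (\<Sum>(x,K)\<in>p. e * measure lborel K)"
    using pd(1) pq(4) e by (intro sum_mono2) auto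
  also have "\<dots> = e * (b - a)"
    using additive_content_tagged_division[of p a b] p(1) ab
    by (simp add: sum_distrib_left[symmetric] split_def)
  finally have s2: "(\<Sum>(x,K)\<in>q2. f (Sup K) - f (Inf K)) \<le> e * (b - a)" .
  have "f b - f a = (\<Sum>(x,K)\<in>p. f (Sup K) - f (Inf K))"
    by (rule additive_tagged_division_1[OF ab p(1), symmetric])
  also have "\<dots> = (\<Sum>(x,K)\<in>q1. f (Sup K) - f (Inf K)) + (\<Sum>(x,K)\<in>q2. f (Sup K) - f (Inf K))"
    by (subst pq(1), rule sum.union_disjoint[OF pq(5,6,2)])
  also have "\<dots> \<le> e + e * (b - a)" using s1 s2 by linarith
  also have "\<dots> = e * (b - a + 1)" by (simp add: algebra_simps)
  also have "\<dots> = e0" using ab by (simp add: e_def)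
  finally show "f b \<le> f a + e0" by linarith
qed

text \<open>Lebesgue differentiation, needed because \<open>d\<close> is only measurable. The
  two-sided derivative is assembled from one-sided averages: outside \<open>N1\<close> those over
  intervals to the right of the point converge, and reflection turns intervals to the left into the
  same situation, with exceptional set \<open>N2\<close>.\<close>

lemma indefinite_integral_has_real_derivative_ae:
  fixes f :: "real \<Rightarrow> real"
  assumes f: "\<And>a b. f integrable_on {a..b}"
  obtains E where "negligible E"
    "\<And>x. \<lbrakk>x \<notin> E; s < x\<rbrakk> \<Longrightarrow> ((\<lambda>t. integral {s..t} f) has_real_derivative f x) (at x)"
proof -
  have f': "(\<lambda>x. f (- x)) integrable_on {a..b}" for a b
    using f[of "-b" "-a"] Henstock_Kurzweil_Integration.integrable_reflect_real[where f=f and a="-b" and b="-a"] by simp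
  obtain N1 where N1: "negligible N1" "\<And>x e. \<lbrakk>x \<notin> N1; 0 < e\<rbrakk> \<Longrightarrow>
     \<exists>d>0. \<forall>h. 0 < h \<and> h < d \<longrightarrow> norm (integral {x..x + h} f /\<^sub>R h - f x) < e"
    by (rule integrable_ccontinuous_explicit[of f]) (use f in auto)
  obtain N2 where N2: "negligible N2" "\<And>x e. \<lbrakk>x \<notin> N2; 0 < e\<rbrakk> \<Longrightarrow>
     \<exists>d>0. \<forall>h. 0 < h \<and> h < d \<longrightarrow> norm (integral {x..x + h} (\<lambda>x. f (- x)) /\<^sub>R h - f (- x)) < e"
    by (rule integrable_ccontinuous_explicit[of "\<lambda>x. f (- x)"]) (use f' in auto)
  show thesis
  proof
    have "negligible (uminus ` N2)"
      by (rule negligible_differentiable_image_negligible[OF order_refl N2(1) linear_imp_differentiable_on[OF linear_uminus]])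
    then show "negligible (N1 \<union> uminus ` N2)" using N1 by simp
    fix x assume x: "x \<notin> N1 \<union> uminus ` N2" "s < x"
    then have x1: "x \<notin> N1" and x2: "- x \<notin> N2" by (force simp: image_iff)+
    have "\<exists>d>0. \<forall>t. norm (t - x) < d \<longrightarrow> norm (integral {s..t} f - integral {s..x} f - f x * (t - x)) \<le> e * norm (t - x)"
      if e: "e > 0" for e
    proof -
      obtain d1 where d1: "d1 > 0" "\<And>h. \<lbrakk>0 < h; h < d1\<rbrakk> \<Longrightarrow> norm (integral {x..x + h} f /\<^sub>R h - f x) < e"
        using N1(2)[OF x1 e] by blast
      obtain d2 where d2: "d2 > 0" "\<And>h. \<lbrakk>0 < h; h < d2\<rbrakk> \<Longrightarrow> norm (integral {-x..-x + h} (\<lambda>x. f (- x)) /\<^sub>R h - f x) < e"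
        using N2(2)[OF x2 e] by auto
      \<comment> \<open>The bound \<open>x - s\<close> keeps \<open>t\<close> to the right of the
        base point \<open>s\<close>, so that the integrals can be combined.\<close>
      have "norm (integral {s..t} f - integral {s..x} f - f x * (t - x)) \<le> e * norm (t - x)"
        if t: "norm (t - x) < min (min d1 d2) (x - s)" for t
      proof -
        consider "t = x" | "x < t" | "t < x" by linarith
        then show ?thesis
        proof cases
          case 2
          have eq: "integral {s..t} f - integral {s..x} f = integral {x..t} f"
            using Henstock_Kurzweil_Integration.integral_combine[of s x t f] f x 2 by simp
          have "norm (integral {x..t} f /\<^sub>R (t - x) - f x) < e"
            using d1(2)[of "t - x"] 2 t by simp
          then have "\<bar>integral {x..t} f / (t - x) - f x\<bar> * (t - x) \<le> e * (t - x)"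
            using 2 by (intro mult_right_mono) (auto simp: divide_inverse mult.commute)
          also have "\<bar>integral {x..t} f / (t - x) - f x\<bar> * (t - x) = \<bar>integral {x..t} f - f x * (t - x)\<bar>"
            using 2 by (simp add: abs_mult_pos left_diff_distrib)
          finally show ?thesis unfolding eq using 2 by simp
        next
          case 3
          have eq: "integral {s..t} f - integral {s..x} f = - integral {t..x} f"
            using Henstock_Kurzweil_Integration.integral_combine[of s t x f] f x 3 t by simp
          have "integral {-x..-t} (\<lambda>x. f (- x)) = integral {t..x} f"
            by (rule Henstock_Kurzweil_Integration.integral_reflect_real)
          then have "norm (integral {t..x} f /\<^sub>R (x - t) - f x) < e"
            using d2(2)[of "x - t"] 3 t by simp
          then have "\<bar>integral {t..x} f / (x - t) - f x\<bar> * (x - t) \<le> e * (x - t)"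
            using 3 by (intro mult_right_mono) (auto simp: divide_inverse mult.commute)
          also have "\<bar>integral {t..x} f / (x - t) - f x\<bar> * (x - t) = \<bar>integral {t..x} f - f x * (x - t)\<bar>"
            using 3 by (simp add: abs_mult_pos left_diff_distrib)
          finally show ?thesis unfolding eq using 3 by (simp add: algebra_simps)
        qed simp
      qed
      then show ?thesis using d1(1) d2(1) x(2) by (intro exI[of _ "min (min d1 d2) (x - s)"]) auto
    qed
    then show "((\<lambda>t. integral {s..t} f) has_real_derivative f x) (at x)"
      unfolding has_field_derivative_def has_derivative_at_alt by (simp add: bounded_linear_mult_right)
  qed
qed

section \<open>Spectral projections\<close>

declare One_nat_def [simp del]

locale orthonormal =
  fixes \<phi> :: "nat \<Rightarrow> 'a::{real_inner, complete_space}"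
  assumes onb: "orthonormal_basis \<phi>"
begin

lemma inner_basis: "\<lbrakk>1 \<le> i; 1 \<le> j\<rbrakk> \<Longrightarrow> \<phi> i \<bullet> \<phi> j = (if i = j then 1 else 0)"
  using onb by (simp add: orthonormal_basis_def)

lemma inner_sum_basis:
  "1 \<le> j \<Longrightarrow> (\<Sum>i=1..N. c i *\<^sub>R \<phi> i) \<bullet> \<phi> j = (if j \<le> N then c j else 0)"
proof -
  assume j: "1 \<le> j"
  have "(\<Sum>i=1..N. c i *\<^sub>R \<phi> i) \<bullet> \<phi> j = (\<Sum>i=1..N. if i = j then c i else 0)"
    unfolding inner_sum_left using j by (intro sum.cong) (auto simp: inner_basis)
  then show ?thesis using j by simp
qed

lemma subspace_Xc: "subspace (Xc \<phi> N)"
  by (simp add: Xc_def)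

lemma sum_basis_in_Xc: "(\<Sum>i=1..N. c i *\<^sub>R \<phi> i) \<in> Xc \<phi> N"
  unfolding Xc_def by (intro span_sum span_scale span_base) auto

lemma basis_in_Xc: "\<lbrakk>1 \<le> j; j \<le> N\<rbrakk> \<Longrightarrow> \<phi> j \<in> Xc \<phi> N"
  unfolding Xc_def by (intro span_base) auto

lemma Xc_expansion: "x \<in> Xc \<phi> N \<Longrightarrow> (\<Sum>i=1..N. (x \<bullet> \<phi> i) *\<^sub>R \<phi> i) = x"
  unfolding Xc_def
proof (induction rule: span_induct_alt)
  case (step c y x)
  then obtain k where k: "k \<in> {1..N}" "y = \<phi> k" by auto
  have "(\<Sum>i=1..N. (y \<bullet> \<phi> i) *\<^sub>R \<phi> i) = (\<Sum>i=1..N. if i = k then \<phi> i else 0)"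
    using k by (intro sum.cong) (auto simp: inner_basis)
  also have "\<dots> = y" using k by simp
  finally have y: "(\<Sum>i=1..N. (y \<bullet> \<phi> i) *\<^sub>R \<phi> i) = y" .
  have "(\<Sum>i=1..N. ((c *\<^sub>R y + x) \<bullet> \<phi> i) *\<^sub>R \<phi> i)
     = c *\<^sub>R (\<Sum>i=1..N. (y \<bullet> \<phi> i) *\<^sub>R \<phi> i) + (\<Sum>i=1..N. (x \<bullet> \<phi> i) *\<^sub>R \<phi> i)"
    by (simp add: inner_add_left scaleR_add_left sum.distrib scaleR_sum_right)
  then show ?case using y step by simp
qed simp

lemma Xs_iff: "x \<in> Xs \<phi> N \<longleftrightarrow> (\<forall>j\<in>{1..N}. x \<bullet> \<phi> j = 0)"
proof
  assume "x \<in> Xs \<phi> N" then show "\<forall>j\<in>{1..N}. x \<bullet> \<phi> j = 0"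
    by (auto simp: Xs_def orthogonal_comp_def orthogonal_def basis_in_Xc inner_commute)
next
  assume x: "\<forall>j\<in>{1..N}. x \<bullet> \<phi> j = 0"
  have "y \<bullet> x = 0" if "y \<in> Xc \<phi> N" for y
  proof -
    have "y \<bullet> x = (\<Sum>i=1..N. (y \<bullet> \<phi> i) *\<^sub>R \<phi> i) \<bullet> x" using Xc_expansion[OF that] by simp
    also have "\<dots> = 0" unfolding inner_sum_left using x by (intro sum.neutral) (auto simp: inner_commute)
    finally show ?thesis .
  qed
  then show "x \<in> Xs \<phi> N" by (simp add: Xs_def orthogonal_comp_def orthogonal_def)
qed

lemma Xc_Xs_inner: "\<lbrakk>x \<in> Xc \<phi> N; y \<in> Xs \<phi> N\<rbrakk> \<Longrightarrow> x \<bullet> y = 0"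
  by (simp add: Xs_def orthogonal_comp_def orthogonal_def)

lemma subspace_Xs: "subspace (Xs \<phi> N)"
  by (simp add: Xs_def subspace_orthogonal_comp)

text \<open>The Fourier sum is a candidate for the projection; it is the only one because the
  difference of two candidates lies both in \<open>Xc \<phi> N\<close> and in its orthogonal
  complement.\<close>

lemma Pr_eq: "Pr \<phi> N x = (\<Sum>i=1..N. (x \<bullet> \<phi> i) *\<^sub>R \<phi> i)"
  unfolding Pr_def orth_proj_def
proof (rule the_equality)
  let ?y = "\<Sum>i=1..N. (x \<bullet> \<phi> i) *\<^sub>R \<phi> i"
  have "x - ?y \<in> Xs \<phi> N" by (auto simp: Xs_iff inner_diff_left inner_sum_basis)
  then show *: "?y \<in> Xc \<phi> N \<and> x - ?y \<in> (Xc \<phi> N)\<^sup>\<bottom>"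
    by (simp add: sum_basis_in_Xc Xs_def)
  fix y assume y: "y \<in> Xc \<phi> N \<and> x - y \<in> (Xc \<phi> N)\<^sup>\<bottom>"
  have "y - ?y \<in> Xc \<phi> N" using y * subspace_diff[OF subspace_Xc] by blast
  moreover have "(x - ?y) - (x - y) \<in> (Xc \<phi> N)\<^sup>\<bottom>"
    using y * subspace_diff[OF subspace_orthogonal_comp] by blast
  then have "y - ?y \<in> Xs \<phi> N" by (simp add: Xs_def)
  ultimately have "(y - ?y) \<bullet> (y - ?y) = 0" by (rule Xc_Xs_inner)
  then show "y = ?y" by simp
qed

lemma bounded_linear_Pr: "bounded_linear (Pr \<phi> N)"
  unfolding Pr_eq
  by (intro bounded_linear_sum bounded_linear_scaleR_const bounded_linear_inner_left)

lemma linear_Pr: "linear (Pr \<phi> N)"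
  by (rule bounded_linear.linear[OF bounded_linear_Pr])

lemma Pr_in_Xc: "Pr \<phi> N x \<in> Xc \<phi> N"
  by (simp add: Pr_eq sum_basis_in_Xc)

lemma Pr_Xc: "x \<in> Xc \<phi> N \<Longrightarrow> Pr \<phi> N x = x"
  by (simp add: Pr_eq Xc_expansion)

lemma Qr_in_Xs: "Qr \<phi> N x \<in> Xs \<phi> N"
  by (auto simp: Qr_def Xs_iff Pr_eq inner_diff_left inner_sum_basis)

lemma Pr_Xs: "x \<in> Xs \<phi> N \<Longrightarrow> Pr \<phi> N x = 0"
  by (auto simp: Pr_eq Xs_iff)

lemma Qr_Xs: "x \<in> Xs \<phi> N \<Longrightarrow> Qr \<phi> N x = x"
  by (simp add: Qr_def Pr_Xs)

lemma bounded_linear_Qr: "bounded_linear (Qr \<phi> N)"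
  unfolding Qr_def by (intro bounded_linear_sub bounded_linear_ident bounded_linear_Pr)

lemma Pr_inner: "Pr \<phi> N x \<bullet> y = Pr \<phi> N x \<bullet> Pr \<phi> N y"
  using Xc_Xs_inner[OF Pr_in_Xc Qr_in_Xs, of N x y] by (simp add: Qr_def inner_diff_right)

lemma Xc_inner_Pr: "x \<in> Xc \<phi> N \<Longrightarrow> x \<bullet> Pr \<phi> N y = x \<bullet> y"
  using Pr_inner[of N x y] by (simp add: Pr_Xc)

lemma Xs_inner_Qr: "x \<in> Xs \<phi> N \<Longrightarrow> x \<bullet> Qr \<phi> N y = x \<bullet> y"
  using Xc_Xs_inner[OF Pr_in_Xc, of x N y] by (simp add: Qr_def inner_diff_right inner_commute)

lemma norm_sq_Pr_Qr: "(norm x)\<^sup>2 = (norm (Pr \<phi> N x))\<^sup>2 + (norm (Qr \<phi> N x))\<^sup>2"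
proof -
  have "(norm x)\<^sup>2 = (Pr \<phi> N x + Qr \<phi> N x) \<bullet> (Pr \<phi> N x + Qr \<phi> N x)"
    by (simp add: Qr_def power2_norm_eq_inner)
  then show ?thesis
    using Xc_Xs_inner[OF Pr_in_Xc Qr_in_Xs, of N x x]
    by (simp add: inner_add_left inner_add_right inner_commute power2_norm_eq_inner)
qed

lemma norm_Pr_le: "norm (Pr \<phi> N x) \<le> norm x"
  by (rule power2_le_imp_le) (simp_all add: norm_sq_Pr_Qr[of x N])

lemma norm_Qr_le: "norm (Qr \<phi> N x) \<le> norm x"
  by (rule power2_le_imp_le) (simp_all add: norm_sq_Pr_Qr[of x N])

lemma norm_Qr_best: "y \<in> Xc \<phi> N \<Longrightarrow> norm (Qr \<phi> N x) \<le> norm (x - y)"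
proof -
  assume "y \<in> Xc \<phi> N"
  then have "Qr \<phi> N (x - y) = Qr \<phi> N x"
    by (simp add: Qr_def linear_diff[OF linear_Pr] Pr_Xc)
  then show ?thesis using norm_Qr_le[of N "x - y"] by simp
qed

lemma Xc_mono: "M \<le> N \<Longrightarrow> Xc \<phi> M \<subseteq> Xc \<phi> N"
  unfolding Xc_def by (intro span_mono) auto

lemma span_basis_in_Xc:
  assumes "y \<in> span (\<phi> ` {1..})" shows "\<exists>n. y \<in> Xc \<phi> n"
  using assms
proof (induction rule: span_induct_alt)
  case base show ?case using subspace_0[OF subspace_Xc] by blast
next
  case (step c x y)
  then obtain j n where j: "1 \<le> j" "x = \<phi> j" and n: "y \<in> Xc \<phi> n" by auto
  have "x \<in> Xc \<phi> (max j n)" "y \<in> Xc \<phi> (max j n)"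
    using j n Xc_mono[of n "max j n"] by (auto intro: basis_in_Xc)
  then show ?case using subspace_Xc by (meson subspace_add subspace_scale)
qed

text \<open>A finite net makes pointwise approximation uniform: balls of radius \<open>e\<close>
  centred in the dense span cover \<open>K\<close>, finitely many suffice, their centres lie in
  \<open>Xc \<phi> m\<close> for all large \<open>m\<close>, and the projection error is at most the
  distance to any point of that space.\<close>

lemma Pr_uniform_approximation:
  assumes K: "compact K" and e: "0 < e"
  obtains n where "\<And>m x. \<lbrakk>n \<le> m; x \<in> K\<rbrakk> \<Longrightarrow> norm (Qr \<phi> m x) \<le> e"
proof -
  let ?S = "span (\<phi> ` {1..})"
  have "K \<subseteq> (\<Union>y\<in>?S. ball y e)"
  proof
    fix x
    have "x \<in> closure ?S" using onb by (simp add: orthonormal_basis_def)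
    then obtain y where "y \<in> ?S" "dist y x < e" using e closure_approachable by metis
    then show "x \<in> (\<Union>y\<in>?S. ball y e)" by auto
  qed
  then obtain F where F: "F \<subseteq> ?S" "finite F" "K \<subseteq> (\<Union>y\<in>F. ball y e)"
    using compactE_image[OF K, of ?S "\<lambda>y. ball y e"] by auto
  have "\<forall>y\<in>F. \<exists>n. y \<in> Xc \<phi> n" using F(1) span_basis_in_Xc by blast
  then obtain N where N: "\<And>y. y \<in> F \<Longrightarrow> y \<in> Xc \<phi> (N y)" by metis
  show thesis
  \<comment> \<open>The inserted \<open>0\<close> keeps \<open>Max\<close> meaningful when the net
    is empty.\<close>
  proof (rule that[of "Max (insert 0 (N ` F))"])
    fix m x assume m: "Max (insert 0 (N ` F)) \<le> m" and "x \<in> K"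
    then obtain y where y: "y \<in> F" "dist y x < e" using F(3) by auto
    then have "N y \<le> m" using m F(2) by auto
    then have "y \<in> Xc \<phi> m" using N[OF y(1)] Xc_mono by blast
    then have "norm (Qr \<phi> m x) \<le> norm (x - y)" by (rule norm_Qr_best)
    then show "norm (Qr \<phi> m x) \<le> e" using y by (simp add: dist_norm norm_minus_commute)
  qed
qed

lemma norm_sq_sum_basis:
  assumes "I \<subseteq> {1..}" "finite I"
  shows "(norm (\<Sum>i\<in>I. c i *\<^sub>R \<phi> i))\<^sup>2 = (\<Sum>i\<in>I. (c i)\<^sup>2)"
proof -
  have "(norm (\<Sum>i\<in>I. c i *\<^sub>R \<phi> i))\<^sup>2 = (\<Sum>i\<in>I. \<Sum>j\<in>I. c i * c j * (\<phi> i \<bullet> \<phi> j))"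
    unfolding power2_norm_eq_inner inner_sum_left inner_sum_right
    by (simp add: inner_commute mult_ac)
  also have "\<dots> = (\<Sum>i\<in>I. \<Sum>j\<in>I. if j = i then c i * c j else 0)"
    using assms(1) by (intro sum.cong refl) (auto simp: inner_basis subset_iff)
  also have "\<dots> = (\<Sum>i\<in>I. (c i)\<^sup>2)"
    using assms by (simp add: power2_eq_square)
  finally show ?thesis .
qed

section \<open>Bessel's inequality and the diagonal semigroup\<close>

lemma Bessel_summable: "summable (\<lambda>j. (x \<bullet> \<phi> (Suc j))\<^sup>2)"
proof (rule bounded_imp_summable)
  fix n
  have "(\<Sum>j\<le>n. (x \<bullet> \<phi> (Suc j))\<^sup>2) = (\<Sum>i=1..Suc n. (x \<bullet> \<phi> i)\<^sup>2)"
    by (rule sum.reindex_bij_witness[of _ "\<lambda>i. i - 1" Suc]) auto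
  also have "\<dots> = (norm (Pr \<phi> (Suc n) x))\<^sup>2"
    unfolding Pr_eq by (subst norm_sq_sum_basis) auto
  also have "\<dots> \<le> (norm x)\<^sup>2" by (intro power_mono norm_Pr_le) auto
  finally show "(\<Sum>j\<le>n. (x \<bullet> \<phi> (Suc j))\<^sup>2) \<le> (norm x)\<^sup>2" .
qed simp

text \<open>By Pythagoras the squared norm of a block of the series is the sum of its squared
  coefficients, which Bessel's series for \<open>x\<close> dominates; completeness gives the limit.
  The semigroup series is of this kind, with damping factors at most one.\<close>

lemma summable_basis_expansion:
  assumes c: "\<And>j. \<bar>c j\<bar> \<le> \<bar>x \<bullet> \<phi> (Suc j)\<bar>"
  shows "summable (\<lambda>j. c j *\<^sub>R \<phi> (Suc j))"
proof -
  let ?X = "\<lambda>n. \<Sum>j<n. c j *\<^sub>R \<phi> (Suc j)"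
  have "Cauchy ?X"
  proof (rule CauchyI)
    fix e :: real assume e: "e > 0"
    then have "e\<^sup>2 > 0" by simp
    then obtain N where N: "\<And>m n. m \<ge> N \<Longrightarrow> norm (\<Sum>j=m..<n. (x \<bullet> \<phi> (Suc j))\<^sup>2) < e\<^sup>2"
      using Bessel_summable[of x] unfolding summable_Cauchy by meson
    have *: "norm (?X n - ?X m) < e" if m: "N \<le> m" "m \<le> n" for m n
    proof -
      have "?X n - ?X m = (\<Sum>j=m..<n. c j *\<^sub>R \<phi> (Suc j))"
        using sum_diff_nat_ivl[of 0 m n "\<lambda>j. c j *\<^sub>R \<phi> (Suc j)"] m by (simp add: lessThan_atLeast0)
      also have "\<dots> = (\<Sum>i\<in>Suc ` {m..<n}. c (i - 1) *\<^sub>R \<phi> i)"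
        by (subst sum.reindex) (auto simp: o_def)
      finally have eq: "?X n - ?X m = (\<Sum>i\<in>Suc ` {m..<n}. c (i - 1) *\<^sub>R \<phi> i)" .
      have "(norm (?X n - ?X m))\<^sup>2 = (\<Sum>i\<in>Suc ` {m..<n}. (c (i - 1))\<^sup>2)"
        unfolding eq by (rule norm_sq_sum_basis) auto
      also have "\<dots> = (\<Sum>j=m..<n. (c j)\<^sup>2)" by (subst sum.reindex) (auto simp: o_def)
      also have "\<dots> \<le> (\<Sum>j=m..<n. (x \<bullet> \<phi> (Suc j))\<^sup>2)"
        using c by (intro sum_mono) (simp add: abs_le_square_iff)
      also have "\<dots> < e\<^sup>2" using N[OF m(1), of n] by (simp add: sum_nonneg)
      finally show ?thesis using e by (simp add: power2_less_imp_less)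
    qed
    show "\<exists>M. \<forall>m\<ge>M. \<forall>n\<ge>M. norm (?X m - ?X n) < e"
    proof (intro exI[of _ N] allI impI)
      fix m n assume "N \<le> m" "N \<le> n"
      then show "norm (?X m - ?X n) < e"
        using *[of m n] *[of n m] by (cases "m \<le> n") (auto simp: norm_minus_commute)
    qed
  qed
  then show ?thesis by (simp add: summable_iff_convergent Cauchy_convergent_iff)
qed

text \<open>\<open>suminf\<close> is informative only for a convergent series. Nonnegative time and
  eigenvalues keep the exponential factors at most one, which secures convergence; pairing with
  \<open>\<phi> k\<close> then leaves a single term, at the shifted index
  \<open>k - 1\<close>.\<close>

lemma diag_semigroup_coefficient:
  assumes "0 \<le> \<tau>" "\<And>j. 0 \<le> lam (Suc j)" "1 \<le> k"
  shows "diag_semigroup \<phi> lam \<tau> x \<bullet> \<phi> k = exp (- \<tau> * lam k) * (x \<bullet> \<phi> k)"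
proof -
  obtain k' where k': "k = Suc k'" using assms(3) by (cases k) auto
  let ?g = "\<lambda>j. (exp (- \<tau> * lam (Suc j)) * (x \<bullet> \<phi> (Suc j))) *\<^sub>R \<phi> (Suc j)"
  have "summable ?g"
    using assms by (intro summable_basis_expansion[of _ x]) (auto simp: abs_mult intro: mult_left_le_one_le)
  then have "(\<lambda>j. ?g j \<bullet> \<phi> k) sums (diag_semigroup \<phi> lam \<tau> x \<bullet> \<phi> k)"
    unfolding diag_semigroup_def using summable_sums bounded_linear.sums[OF bounded_linear_inner_left] by blast
  moreover have "(\<lambda>j. ?g j \<bullet> \<phi> k) sums (?g k' \<bullet> \<phi> k)"
    using sums_finite[of "{k'}" "\<lambda>j. ?g j \<bullet> \<phi> k"] by (simp add: k' inner_basis)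
  ultimately have "diag_semigroup \<phi> lam \<tau> x \<bullet> \<phi> k = ?g k' \<bullet> \<phi> k" by (rule sums_unique2)
  then show ?thesis by (simp add: k' inner_basis)
qed

text \<open>Closed bounded sets need not be compact in the ambient space, so a compact superset is
  built by induction: the coordinate cube for \<open>Suc N\<close> lies in a continuous image of
  \<open>[-1, 1]\<close> times the compact set for \<open>N\<close>. The sphere is closed because
  \<open>Xc \<phi> N\<close> is the fixed point set of a continuous projection.\<close>

lemma compact_Xc_sphere: "compact (Xc \<phi> N \<inter> sphere 0 1)"
proof -
  have "\<exists>K. compact K \<and> {\<Sum>i=1..N. c i *\<^sub>R \<phi> i | c. \<forall>i. \<bar>c i\<bar> \<le> 1} \<subseteq> K"
  proof (induction N)
    case 0 show ?case by (auto intro!: exI[of _ "{0}"])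
  next
    case (Suc N)
    then obtain K where K: "compact K" "{\<Sum>i=1..N. c i *\<^sub>R \<phi> i | c. \<forall>i. \<bar>c i\<bar> \<le> 1} \<subseteq> K" by blast
    let ?K = "(\<lambda>(r, y). y + r *\<^sub>R \<phi> (Suc N)) ` ({-1..1::real} \<times> K)"
    have "compact ?K"
      by (intro compact_continuous_image compact_Times K compact_Icc)
         (auto simp: split_def intro!: continuous_intros)
    moreover have "{\<Sum>i=1..Suc N. c i *\<^sub>R \<phi> i | c. \<forall>i. \<bar>c i\<bar> \<le> 1} \<subseteq> ?K"
    proof clarify
      fix c :: "nat \<Rightarrow> real" assume c: "\<forall>i. \<bar>c i\<bar> \<le> 1"
      then have "(\<Sum>i=1..N. c i *\<^sub>R \<phi> i) \<in> K"
        by (intro subsetD[OF K(2)] CollectI exI[of _ c]) simp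
      moreover have "c (Suc N) \<in> {-1..1}"
        using c[rule_format, of "Suc N"] unfolding abs_le_iff by simp
      ultimately have "(c (Suc N), \<Sum>i=1..N. c i *\<^sub>R \<phi> i) \<in> {-1..1} \<times> K" by simp
      then show "(\<Sum>i=1..Suc N. c i *\<^sub>R \<phi> i) \<in> ?K"
        by (rule image_eqI[rotated]) simp
    qed
    ultimately show ?case by blast
  qed
  then obtain K where K: "compact K" "{\<Sum>i=1..N. c i *\<^sub>R \<phi> i | c. \<forall>i. \<bar>c i\<bar> \<le> 1} \<subseteq> K" by blast
  have "Xc \<phi> N \<inter> sphere 0 1 \<subseteq> K"
  proof
    fix x assume x: "x \<in> Xc \<phi> N \<inter> sphere 0 1"
    \<comment> \<open>Coefficients outside \<open>{1..N}\<close> are cut to zero because the cube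
      bounds all of them and nothing is known about \<open>\<phi> 0\<close>.\<close>
    define c where "c i = (if i \<in> {1..N} then x \<bullet> \<phi> i else 0)" for i
    have "\<bar>x \<bullet> \<phi> i\<bar> \<le> 1" if "i \<ge> 1" for i
      using Cauchy_Schwarz_ineq2[of x "\<phi> i"] x that inner_basis[of i i] by (simp add: norm_eq_sqrt_inner)
    then have "\<forall>i. \<bar>c i\<bar> \<le> 1" by (auto simp: c_def)
    moreover have "x = (\<Sum>i=1..N. c i *\<^sub>R \<phi> i)"
      using Xc_expansion[of x N] x by (simp add: c_def)
    ultimately show "x \<in> K" by (intro subsetD[OF K(2)] CollectI exI[of _ c]) simp
  qed
  moreover have "closed (Xc \<phi> N \<inter> sphere 0 1)"
  proof -
    have "x \<in> Xc \<phi> N" if "Pr \<phi> N x = x" for x using Pr_in_Xc[of N x] that by simp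
    then have "Xc \<phi> N = {x. Pr \<phi> N x = x}" using Pr_Xc by blast
    moreover have "closed {x. Pr \<phi> N x = x}"
      by (intro closed_Collect_eq continuous_intros linear_continuous_on bounded_linear_Pr)
    ultimately have "closed (Xc \<phi> N)" by simp
    moreover have "closed (sphere (0::'a) 1)"
      unfolding sphere_def by (intro closed_Collect_eq continuous_intros)
    ultimately show ?thesis by (rule closed_Int)
  qed
  ultimately show ?thesis
    using compact_Int_closed[OF K(1), of "Xc \<phi> N \<inter> sphere 0 1"] by (simp only: inf.absorb2)
qed

text \<open>Bounds the dimension, which is the induction measure in the construction of square
  roots.\<close>

lemma Xc_independent_bound:
  assumes "independent B" "B \<subseteq> Xc \<phi> N" shows "finite B \<and> card B \<le> N"
proof -
  have "finite B \<and> card B \<le> card (\<phi> ` {1..N})"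
    using assms by (intro independent_span_bound) (auto simp: Xc_def)
  then show ?thesis using card_image_le[of "{1..N}" \<phi>] by auto
qed

text \<open>An operator on \<open>Xc \<phi> N\<close> is specified only there. Composed with the
  projection it becomes a total operator that depends on the finitely many values
  \<open>T (\<phi> i)\<close> through bounded coordinate functionals.\<close>

lemma linear_on_Xc_bounded_linear:
  assumes "linear_on_sub (Xc \<phi> N) T"
  shows "bounded_linear (\<lambda>x. T (Pr \<phi> N x))"
proof -
  have T: "T (\<Sum>i=1..n. c i *\<^sub>R \<phi> i) = (\<Sum>i=1..n. c i *\<^sub>R T (\<phi> i))" if "n \<le> N" for n and c :: "nat \<Rightarrow> real"
    using that
  proof (induction n)
    case 0
    have "T (0 *\<^sub>R 0) = 0 *\<^sub>R T 0"
      using assms subspace_0[OF subspace_Xc] unfolding linear_on_sub_def by blast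
    then show ?case by simp
  next
    case (Suc n)
    have "(\<Sum>i=1..n. c i *\<^sub>R \<phi> i) \<in> Xc \<phi> N"
      using sum_basis_in_Xc Xc_mono[of n N] Suc.prems by (meson Suc_leD subsetD)
    moreover have "\<phi> (Suc n) \<in> Xc \<phi> N" using Suc.prems by (intro basis_in_Xc) auto
    moreover have "c (Suc n) *\<^sub>R \<phi> (Suc n) \<in> Xc \<phi> N"
      using calculation subspace_scale[OF subspace_Xc] by blast
    ultimately show ?case using Suc assms by (simp add: linear_on_sub_def)
  qed
  have "(\<lambda>x. T (Pr \<phi> N x)) = (\<lambda>x. \<Sum>i=1..N. (x \<bullet> \<phi> i) *\<^sub>R T (\<phi> i))"
    unfolding Pr_eq using T by simp
  then show ?thesis
    by (simp add: bounded_linear_sum bounded_linear_scaleR_const bounded_linear_inner_left)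
qed

end

section \<open>Square roots of positive definite operators\<close>

lemma linear_on_subD:
  assumes "linear_on_sub S T"
  shows "subspace S" "\<And>x y. \<lbrakk>x \<in> S; y \<in> S\<rbrakk> \<Longrightarrow> T (x + y) = T x + T y"
    "\<And>c x. x \<in> S \<Longrightarrow> T (c *\<^sub>R x) = c *\<^sub>R T x" "T 0 = 0"
    "\<And>x y. \<lbrakk>x \<in> S; y \<in> S\<rbrakk> \<Longrightarrow> T (x - y) = T x - T y"
proof -
  show 1: "subspace S" "\<And>x y. \<lbrakk>x \<in> S; y \<in> S\<rbrakk> \<Longrightarrow> T (x + y) = T x + T y"
    "\<And>c x. x \<in> S \<Longrightarrow> T (c *\<^sub>R x) = c *\<^sub>R T x"
    using assms by (auto simp: linear_on_sub_def)
  show "T 0 = 0" using 1(3)[of 0 0] 1(1) by (simp add: subspace_0)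
  show "T (x - y) = T x - T y" if "x \<in> S" "y \<in> S" for x y
    using 1(2)[of x "- y"] 1(3)[of y "-1"] that 1(1) by (simp add: subspace_neg)
qed

lemma selfadj_onD:
  assumes "selfadj_on S T"
  shows "linear_on_sub S T" "\<And>x. x \<in> S \<Longrightarrow> T x \<in> S"
    "\<And>x y. \<lbrakk>x \<in> S; y \<in> S\<rbrakk> \<Longrightarrow> T x \<bullet> y = x \<bullet> T y"
  using assms by (auto simp: selfadj_on_def)

lemma posdef_onD:
  assumes "posdef_on S T"
  shows "selfadj_on S T" "\<And>x. \<lbrakk>x \<in> S; x \<noteq> 0\<rbrakk> \<Longrightarrow> 0 < T x \<bullet> x"
  using assms by (auto simp: posdef_on_def)

lemma posdef_on_inj_on: "posdef_on S T \<Longrightarrow> inj_on T S"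
proof (rule inj_onI, rule ccontr)
  fix x y assume T: "posdef_on S T" and xy: "x \<in> S" "y \<in> S" "T x = T y" "x \<noteq> y"
  note l = linear_on_subD[OF selfadj_onD(1)[OF posdef_onD(1)[OF T]]]
  have "0 < T (x - y) \<bullet> (x - y)" using posdef_onD(2)[OF T] subspace_diff[OF l(1)] xy by simp
  then show False using l(5) xy by simp
qed

text \<open>A maximiser of the Rayleigh quotient on the unit sphere is an eigenvector.\<close>

lemma selfadj_on_eigenvector:
  fixes T :: "'a::real_inner \<Rightarrow> 'a"
  assumes T: "selfadj_on S T" and cpt: "compact (S \<inter> sphere 0 1)" and ne: "S \<noteq> {0}"
    and cont: "continuous_on S T"
  obtains e c where "e \<in> S" "norm e = 1" "T e = c *\<^sub>R e"
proof -
  note l = linear_on_subD[OF selfadj_onD(1)[OF T]] and sa = selfadj_onD[OF T]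
  obtain x0 where x0: "x0 \<in> S" "x0 \<noteq> 0" using ne subspace_0[OF l(1)] by auto
  then have "(1 / norm x0) *\<^sub>R x0 \<in> S \<inter> sphere 0 1" using l(1) by (simp add: subspace_scale)
  then have "S \<inter> sphere 0 1 \<noteq> {}" by blast
  moreover have "continuous_on (S \<inter> sphere 0 1) (\<lambda>x. T x \<bullet> x)"
    by (intro continuous_intros continuous_on_subset[OF cont]) auto
  ultimately obtain e where e': "e \<in> S \<inter> sphere 0 1"
    and emax: "\<And>x. x \<in> S \<inter> sphere 0 1 \<Longrightarrow> T x \<bullet> x \<le> T e \<bullet> e"
    using continuous_attains_sup[OF cpt, of "\<lambda>x. T x \<bullet> x"] by blast
  have e: "e \<in> S" "norm e = 1" using e' by auto
  define c where "c = T e \<bullet> e"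
  have pos: "0 \<le> c * (x \<bullet> x) - T x \<bullet> x" if x: "x \<in> S" for x
  proof (cases "x = 0")
    case False
    have "(1 / norm x) *\<^sub>R x \<in> S \<inter> sphere 0 1" using False x l(1) by (simp add: subspace_scale)
    from emax[OF this] have "(T x \<bullet> x) / (norm x)\<^sup>2 \<le> c"
      using x l(3) by (simp add: c_def power2_eq_square)
    then show ?thesis using False by (simp add: divide_le_eq power2_norm_eq_inner)
  qed simp
  have ee: "e \<bullet> e = 1" using e by (simp add: dot_square_norm)
  have "(c *\<^sub>R e - T e) \<bullet> y = 0" if y: "y \<in> S" for y
  proof (rule ccontr)
    define b where "b = (c *\<^sub>R e - T e) \<bullet> y"
    define q where "q = c * (y \<bullet> y) - T y \<bullet> y"
    assume "(c *\<^sub>R e - T e) \<bullet> y \<noteq> 0"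
    then have b: "b \<noteq> 0" by (simp add: b_def)
    have q0: "0 \<le> q" using pos[OF y] by (simp add: q_def)
    have poly: "0 \<le> 2 * t * b + t\<^sup>2 * q" for t
    proof -
      have "e + t *\<^sub>R y \<in> S" using e y l(1) by (simp add: subspace_add subspace_scale)
      moreover have "T (e + t *\<^sub>R y) = T e + t *\<^sub>R T y"
        using e y l by (simp add: subspace_scale)
      moreover have "T y \<bullet> e = T e \<bullet> y" using sa(3)[of y e] e y by (simp add: inner_commute)
      ultimately show ?thesis using pos[of "e + t *\<^sub>R y"]
        by (simp add: b_def q_def c_def[symmetric] ee inner_add_left inner_add_right inner_diff_left
            inner_commute[of y e] algebra_simps power2_eq_square)
    qed
    \<comment> \<open>A nonnegative quadratic in \<open>t\<close> that vanishes at \<open>0\<close>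
      has no linear part: at \<open>t = - r\<close> it would equal
      \<open>- (r\<^sup>2 * (q + 2))\<close>. Using \<open>q + 1\<close> instead of \<open>q\<close>
      covers \<open>q = 0\<close>.\<close>
    define r where "r = b / (q + 1)"
    have r: "b = r * (q + 1)" "r \<noteq> 0" using q0 b by (auto simp: r_def)
    have "0 \<le> 2 * (- r) * b + (- r)\<^sup>2 * q" by (rule poly)
    also have "\<dots> = - (r\<^sup>2 * (q + 2))"
      unfolding r(1) by (simp add: power2_eq_square algebra_simps)
    also have "\<dots> < 0" using r(2) q0 by simp
    finally show False by simp
  qed
  moreover have "c *\<^sub>R e - T e \<in> S" using e l(1) sa(2) by (simp add: subspace_diff subspace_scale)
  ultimately have "c *\<^sub>R e - T e = 0" by (metis inner_eq_zero_iff)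
  then show thesis using e by (intro that[of e c]) auto
qed

text \<open>Induction on a bound for the dimension: split off a unit eigenvector \<open>e\<close>
  with eigenvalue \<open>c > 0\<close>, whose orthogonal complement in \<open>S\<close> is
  invariant, and join \<open>sqrt c\<close> on \<open>e\<close> to a root on the complement.
  Surjectivity is carried along because the same splitting solves \<open>T x = y\<close>; it is what
  makes the inverses behave later.\<close>

lemma posdef_on_sqrt_exists:
  fixes T :: "'a::real_inner \<Rightarrow> 'a"
  assumes "posdef_on S T" "compact (S \<inter> sphere 0 1)" "continuous_on S T"
    and "\<And>B. \<lbrakk>independent B; B \<subseteq> S\<rbrakk> \<Longrightarrow> finite B \<and> card B \<le> n"
  shows "T ` S = S \<and> (\<exists>R. posdef_on S R \<and> (\<forall>x\<in>S. R (R x) = T x))"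
  using assms
proof (induction n arbitrary: S)
  case (0 S)
  have "x = 0" if "x \<in> S" for x
  proof (rule ccontr)
    assume "x \<noteq> 0"
    then have "independent {x}" by simp
    then show False using "0.prems"(4)[of "{x}"] that by auto
  qed
  then have S: "S = {0}"
    using subspace_0[OF linear_on_subD(1)[OF selfadj_onD(1)[OF posdef_onD(1)[OF "0.prems"(1)]]]] by auto
  have "T 0 = 0"
    using linear_on_subD(4)[OF selfadj_onD(1)[OF posdef_onD(1)[OF "0.prems"(1)]]] .
  then show ?case using "0.prems"(1) S by (auto intro!: exI[of _ T])
next
  case (Suc n S)
  note T = Suc.prems(1)
  note sa = selfadj_onD[OF posdef_onD(1)[OF T]]
  note l = linear_on_subD[OF sa(1)]
  show ?case
  proof (cases "S = {0}")
    case True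
    then show ?thesis using T l(4) by (auto intro!: exI[of _ T])
  next
    case False
    obtain e c where e: "e \<in> S" "norm e = 1" "T e = c *\<^sub>R e"
      using selfadj_on_eigenvector[OF posdef_onD(1)[OF T] Suc.prems(2) False Suc.prems(3)] .
    have ee: "e \<bullet> e = 1" using e by (simp add: dot_square_norm)
    have "e \<noteq> 0" using ee by auto
    then have c: "c > 0" using posdef_onD(2)[OF T, of e] e ee by simp
    define S' where "S' = S \<inter> {x. e \<bullet> x = 0}"
    have sS': "subspace S'"
      unfolding S'_def using l(1) by (intro subspace_inter) (auto simp: subspace_def inner_add_right)
    have TS': "T x \<in> S'" if "x \<in> S'" for x
      using sa(2)[of x] sa(3)[of e x] e that by (simp add: S'_def)
    have T': "posdef_on S' T"
      unfolding posdef_on_def selfadj_on_def linear_on_sub_def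
      using sS' TS' l sa posdef_onD(2)[OF T] by (auto simp: S'_def)
    have "T ` S' = S' \<and> (\<exists>R. posdef_on S' R \<and> (\<forall>x\<in>S'. R (R x) = T x))"
    proof (rule Suc.IH[OF T'])
      have "S' \<inter> sphere 0 1 = (S \<inter> sphere 0 1) \<inter> {x. e \<bullet> x = 0}" by (auto simp: S'_def)
      then show "compact (S' \<inter> sphere 0 1)"
        using Suc.prems(2) by (simp add: compact_Int_closed closed_hyperplane)
      show "continuous_on S' T" using Suc.prems(3) by (rule continuous_on_subset) (auto simp: S'_def)
      fix B assume B: "independent B" "B \<subseteq> S'"
      \<comment> \<open>Adjoining \<open>e\<close> to an independent subset of the complement keeps
        it independent, so the dimension bound drops by one.\<close>
      have "e \<notin> S'" using ee by (simp add: S'_def)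
      moreover have "span B \<subseteq> S'" using B(2) sS' by (rule span_minimal)
      ultimately have eB: "e \<notin> span B" by blast
      then have "independent (insert e B)" using B(1) by (simp add: independent_insert)
      then have "finite (insert e B) \<and> card (insert e B) \<le> Suc n"
        using Suc.prems(4)[of "insert e B"] B(2) e(1) by (auto simp: S'_def)
      moreover have "e \<notin> B" using eB span_base by blast
      ultimately show "finite B \<and> card B \<le> n" by (auto simp: card_insert_if)
    qed
    then obtain R' where TS'_eq: "T ` S' = S'" and R': "posdef_on S' R'"
      and RR': "\<And>x. x \<in> S' \<Longrightarrow> R' (R' x) = T x" by blast
    note sa' = selfadj_onD[OF posdef_onD(1)[OF R']]
    note l' = linear_on_subD[OF sa'(1)]
    \<comment> \<open>\<open>q\<close> removes the component along \<open>e\<close>; identities for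
      the root \<open>R\<close> below are checked separately on the \<open>e\<close>-component and
      on the \<open>q\<close>-component.\<close>
    define q where "q x = x - (e \<bullet> x) *\<^sub>R e" for x
    have qS': "q x \<in> S'" if "x \<in> S" for x
      using that e l(1) by (simp add: S'_def q_def inner_diff_right ee subspace_diff subspace_scale)
    have qadd: "q (x + y) = q x + q y" for x y by (simp add: q_def inner_add_right algebra_simps)
    have qsc: "q (r *\<^sub>R x) = r *\<^sub>R q x" for r x by (simp add: q_def scaleR_diff_right)
    have qid: "q x = x" if "x \<in> S'" for x using that by (simp add: q_def S'_def)
    have qe: "q e = 0" by (simp add: q_def ee)
    have eS': "e \<bullet> x = 0" if "x \<in> S'" for x using that by (simp add: S'_def)
    have S'S: "x \<in> S" if "x \<in> S'" for x using that by (simp add: S'_def)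
    have dec: "x = (e \<bullet> x) *\<^sub>R e + q x" for x by (simp add: q_def)
    define R where "R x = (sqrt c * (e \<bullet> x)) *\<^sub>R e + R' (q x)" for x
    have RS: "R x \<in> S" if "x \<in> S" for x
      using S'S[OF sa'(2)[OF qS'[OF that]]] e l(1) by (simp add: R_def subspace_add subspace_scale)
    have eR: "e \<bullet> R x = sqrt c * (e \<bullet> x)" if "x \<in> S" for x
      using eS'[OF sa'(2)[OF qS'[OF that]]] by (simp add: R_def inner_add_right ee)
    have qR: "q (R x) = R' (q x)" if "x \<in> S" for x
      using qid[OF sa'(2)[OF qS'[OF that]]] by (simp add: R_def qadd qsc qe)
    have "R (R x) = T x" if x: "x \<in> S" for x
    proof -
      have "R (R x) = (c * (e \<bullet> x)) *\<^sub>R e + R' (R' (q x))"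
        unfolding R_def[of "R x"] eR[OF x] qR[OF x] using c by (simp add: mult.assoc[symmetric])
      also have "\<dots> = (e \<bullet> x) *\<^sub>R T e + T (q x)" using e RR'[OF qS'[OF x]] by (simp add: mult.commute)
      also have "\<dots> = T ((e \<bullet> x) *\<^sub>R e + q x)"
        using e(1) x l(2,3) S'S[OF qS'[OF x]] subspace_scale[OF l(1) e(1)] by simp
      finally show ?thesis using dec by simp
    qed
    moreover have "posdef_on S R"
      unfolding posdef_on_def selfadj_on_def linear_on_sub_def
    proof (intro conjI ballI allI impI)
      show "subspace S" by (rule l(1))
      show "R ` S \<subseteq> S" using RS by blast
      fix x y assume xy: "x \<in> S" "y \<in> S"
      show "R (x + y) = R x + R y"
        using l'(2)[OF qS' qS'] xy by (simp add: R_def qadd inner_add_right algebra_simps)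
      have split: "u \<bullet> v = (e \<bullet> u) * (e \<bullet> v) + q u \<bullet> q v" for u v
        unfolding q_def inner_diff_left inner_diff_right inner_scaleR_left inner_scaleR_right ee
        by (simp add: inner_commute[of u e])
      have *: "R x \<bullet> y = sqrt c * (e \<bullet> x) * (e \<bullet> y) + R' (q x) \<bullet> q y" if "x \<in> S" for x y
        using split[of "R x" y] eR[OF that] qR[OF that] by simp
      show "R x \<bullet> y = x \<bullet> R y"
        using *[OF xy(1), of y] *[OF xy(2), of x] sa'(3)[OF qS'[OF xy(1)] qS'[OF xy(2)]]
        by (simp add: inner_commute)
      show "0 < R x \<bullet> x" if "x \<noteq> 0"
      proof (cases "q x = 0")
        case True
        then have "e \<bullet> x \<noteq> 0" using dec[of x] that by auto
        then have "0 < (e \<bullet> x)\<^sup>2" by simp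
        then have "0 < sqrt c * (e \<bullet> x)\<^sup>2" using c by (intro mult_pos_pos) simp_all
        then have "0 < sqrt c * (e \<bullet> x) * (e \<bullet> x)" by (simp only: power2_eq_square mult.assoc)
        then show ?thesis using *[OF xy(1), of x] True by simp
      next
        case False
        then have "0 < R' (q x) \<bullet> q x" using posdef_onD(2)[OF R'] qS' xy by blast
        moreover have "0 \<le> sqrt c * (e \<bullet> x) * (e \<bullet> x)" using c by (simp add: mult.assoc)
        ultimately show ?thesis using *[OF xy(1), of x] by simp
      qed
    next
      fix r x assume x: "x \<in> S"
      show "R (r *\<^sub>R x) = r *\<^sub>R R x"
        using l'(3)[OF qS'[OF x], of r] by (simp add: R_def qsc algebra_simps)
    qed
    moreover have "T ` S = S"
    proof
      show "T ` S \<subseteq> S" using sa(2) by blast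
      show "S \<subseteq> T ` S"
      proof
        fix y assume y: "y \<in> S"
        then obtain z where z: "z \<in> S'" "T z = q y" using TS'_eq qS'[OF y] by (metis imageE)
        have "T (((e \<bullet> y) / c) *\<^sub>R e + z) = ((e \<bullet> y) / c) *\<^sub>R T e + T z"
          using e(1) l(2,3) S'S[OF z(1)] subspace_scale[OF l(1) e(1)] by simp
        also have "\<dots> = y" using e(3) z(2) c dec[of y] by simp
        finally show "y \<in> T ` S"
          using S'S[OF z(1)] e(1) l(1) by (intro image_eqI[of _ _ "((e \<bullet> y) / c) *\<^sub>R e + z"]) (auto simp: subspace_add subspace_scale)
      qed
    qed
    ultimately show ?thesis by blast
  qed
qed

section \<open>Operator norms on subspaces\<close>

lemma opnorm_on_bound:
  assumes "bdd_above ((\<lambda>x. norm (T x) / norm x) ` S)" "x \<in> S" "x = 0 \<Longrightarrow> T x = 0"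
  shows "norm (T x) \<le> opnorm_on S T * norm x"
\<comment> \<open>At \<open>x = 0\<close> the quotient is \<open>0 / 0 = 0\<close> and says nothing
  about \<open>T 0\<close>; the last hypothesis supplies that case.\<close>
proof (cases "x = 0")
  case False
  have "norm (T x) / norm x \<le> opnorm_on S T"
    unfolding opnorm_on_def using assms by (intro cSUP_upper)
  then show ?thesis using False by (simp add: divide_le_eq)
qed (use assms in auto)

lemma bdd_above_opnorm_on:
  assumes "\<And>x. x \<in> S \<Longrightarrow> norm (T x) \<le> K * norm x" "0 \<le> K"
  shows "bdd_above ((\<lambda>x. norm (T x) / norm x) ` S)"
proof (rule bdd_aboveI2)
  fix x assume "x \<in> S"
  then show "norm (T x) / norm x \<le> K"
    using assms by (cases "x = 0") (auto simp: divide_le_eq)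
qed

lemma opnorm_on_le:
  assumes "\<And>x. x \<in> S \<Longrightarrow> norm (T x) \<le> K * norm x" "0 \<le> K" "S \<noteq> {}"
  shows "opnorm_on S T \<le> K"
  unfolding opnorm_on_def
proof (rule cSUP_least)
  fix x assume "x \<in> S"
  then show "norm (T x) / norm x \<le> K"
    using assms(1)[of x] assms(2) by (cases "x = 0") (auto simp: divide_le_eq)
qed (rule assms)

lemma opnorm_on_nonneg:
  assumes "bdd_above ((\<lambda>x. norm (T x) / norm x) ` S)" "S \<noteq> {}"
  shows "0 \<le> opnorm_on S T"
proof -
  obtain x where "x \<in> S" using assms(2) by blast
  then have "norm (T x) / norm x \<le> opnorm_on S T"
    unfolding opnorm_on_def using assms(1) by (intro cSUP_upper)
  then show ?thesis by (meson divide_nonneg_nonneg norm_ge_zero order_trans)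
qed

section \<open>Bounds for square roots, coupling norms and the numerical range of
  \<open>L\<close>\<close>

context orthonormal begin

lemma linear_on_Xc_bounded:
  assumes "linear_on_sub (Xc \<phi> N) T"
  obtains K where "0 \<le> K" "\<And>x. x \<in> Xc \<phi> N \<Longrightarrow> norm (T x) \<le> K * norm x"
proof -
  obtain K where K: "0 \<le> K" "\<And>x. norm (T (Pr \<phi> N x)) \<le> norm x * K"
    using bounded_linear.nonneg_bounded[OF linear_on_Xc_bounded_linear[OF assms]] by blast
  then show thesis using Pr_Xc by (intro that[of K]) (metis mult.commute)+
qed

lemma linear_on_Xc_opnorm:
  assumes "linear_on_sub (Xc \<phi> N) T" "x \<in> Xc \<phi> N"
  shows "norm (T x) \<le> opnorm_on (Xc \<phi> N) T * norm x"
proof -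
  obtain K where "0 \<le> K" "\<And>x. x \<in> Xc \<phi> N \<Longrightarrow> norm (T x) \<le> K * norm x"
    using linear_on_Xc_bounded[OF assms(1)] by blast
  then show ?thesis
    using assms linear_on_subD(4)[OF assms(1)] by (intro opnorm_on_bound bdd_above_opnorm_on) auto
qed

lemma posdef_on_Xc:
  assumes T: "posdef_on (Xc \<phi> N) T"
  shows "T ` Xc \<phi> N = Xc \<phi> N"
    and "posdef_on (Xc \<phi> N) (sqrt_on (Xc \<phi> N) T)"
    and "\<And>x. x \<in> Xc \<phi> N \<Longrightarrow> sqrt_on (Xc \<phi> N) T (sqrt_on (Xc \<phi> N) T x) = T x"
proof -
  have "continuous_on (Xc \<phi> N) (\<lambda>x. T (Pr \<phi> N x))"
    using linear_on_Xc_bounded_linear[OF selfadj_onD(1)[OF posdef_onD(1)[OF T]]]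
    by (rule linear_continuous_on)
  then have "continuous_on (Xc \<phi> N) T"
    by (rule continuous_on_eq) (simp add: Pr_Xc)
  then have *: "T ` Xc \<phi> N = Xc \<phi> N \<and> (\<exists>R. posdef_on (Xc \<phi> N) R \<and> (\<forall>x\<in>Xc \<phi> N. R (R x) = T x))"
    using T compact_Xc_sphere Xc_independent_bound by (intro posdef_on_sqrt_exists[where n=N]) auto
  then show "T ` Xc \<phi> N = Xc \<phi> N" by blast
  from * have "posdef_on (Xc \<phi> N) (sqrt_on (Xc \<phi> N) T) \<and> (\<forall>x\<in>Xc \<phi> N. sqrt_on (Xc \<phi> N) T (sqrt_on (Xc \<phi> N) T x) = T x)"
    unfolding sqrt_on_def by (intro someI_ex[of "\<lambda>R. posdef_on (Xc \<phi> N) R \<and> (\<forall>x\<in>Xc \<phi> N. R (R x) = T x)"]) blast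
  then show "posdef_on (Xc \<phi> N) (sqrt_on (Xc \<phi> N) T)"
    "\<And>x. x \<in> Xc \<phi> N \<Longrightarrow> sqrt_on (Xc \<phi> N) T (sqrt_on (Xc \<phi> N) T x) = T x" by blast+
qed

lemma linear_on_inv_into:
  assumes T: "posdef_on (Xc \<phi> N) T"
  shows "linear_on_sub (Xc \<phi> N) (inv_into (Xc \<phi> N) T)"
    and "\<And>x. x \<in> Xc \<phi> N \<Longrightarrow> inv_into (Xc \<phi> N) T x \<in> Xc \<phi> N"
    and "\<And>x. x \<in> Xc \<phi> N \<Longrightarrow> T (inv_into (Xc \<phi> N) T x) = x"
    and "\<And>x. x \<in> Xc \<phi> N \<Longrightarrow> inv_into (Xc \<phi> N) T (T x) = x"
proof -
  let ?I = "inv_into (Xc \<phi> N) T"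
  note l = linear_on_subD[OF selfadj_onD(1)[OF posdef_onD(1)[OF T]]]
  show IS: "?I x \<in> Xc \<phi> N" if "x \<in> Xc \<phi> N" for x
    using that posdef_on_Xc(1)[OF T] by (metis inv_into_into)
  show TI: "T (?I x) = x" if "x \<in> Xc \<phi> N" for x
    using that posdef_on_Xc(1)[OF T] by (metis f_inv_into_f)
  show IT: "?I (T x) = x" if "x \<in> Xc \<phi> N" for x
    using that posdef_on_inj_on[OF T] by simp
  show "linear_on_sub (Xc \<phi> N) ?I"
    unfolding linear_on_sub_def
  proof (intro conjI ballI allI subspace_Xc)
    fix x y assume xy: "x \<in> Xc \<phi> N" "y \<in> Xc \<phi> N"
    have "T (?I x + ?I y) = x + y" using l(2) IS TI xy by simp
    moreover have "?I x + ?I y \<in> Xc \<phi> N" using IS xy subspace_Xc by (simp add: subspace_add)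
    ultimately show "?I (x + y) = ?I x + ?I y" using IT by metis
  next
    fix c x assume x: "x \<in> Xc \<phi> N"
    have "T (c *\<^sub>R ?I x) = c *\<^sub>R x" using l(3) IS TI x by simp
    moreover have "c *\<^sub>R ?I x \<in> Xc \<phi> N" using IS x subspace_Xc by (simp add: subspace_scale)
    ultimately show "?I (c *\<^sub>R x) = c *\<^sub>R ?I x" using IT by metis
  qed
qed

text \<open>A symmetric root \<open>R\<close> satisfies
  \<open>R x \<bullet> R x = R (R x) \<bullet> x\<close>. This rewrites the critical part of the
  Lyapunov function as a squared norm, and it bounds the root by the square root of the operator
  norm.\<close>

lemma norm_sqrt_on:
  assumes T: "posdef_on (Xc \<phi> N) T" and x: "x \<in> Xc \<phi> N"
  shows "(norm (sqrt_on (Xc \<phi> N) T x))\<^sup>2 = T x \<bullet> x"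
    and "norm (sqrt_on (Xc \<phi> N) T x) \<le> sqrt (opnorm_on (Xc \<phi> N) T) * norm x"
proof -
  let ?R = "sqrt_on (Xc \<phi> N) T"
  note sa = selfadj_onD[OF posdef_onD(1)[OF posdef_on_Xc(2)[OF T]]]
  show *: "(norm (?R x))\<^sup>2 = T x \<bullet> x"
    using sa(3)[of "?R x" x] sa(2)[of x] x posdef_on_Xc(3)[OF T x] by (simp add: power2_norm_eq_inner)
  have "T x \<bullet> x \<le> norm (T x) * norm x" by (rule norm_cauchy_schwarz)
  also have "\<dots> \<le> opnorm_on (Xc \<phi> N) T * norm x * norm x"
    using T x by (intro mult_right_mono linear_on_Xc_opnorm) (auto dest: posdef_onD selfadj_onD)
  finally have "norm (?R x) \<le> sqrt (opnorm_on (Xc \<phi> N) T * (norm x)\<^sup>2)"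
    using * by (intro real_le_rsqrt) (simp add: power2_eq_square mult.assoc)
  then show "norm (?R x) \<le> sqrt (opnorm_on (Xc \<phi> N) T) * norm x"
    by (simp add: real_sqrt_mult)
qed

text \<open>Inverting the root twice inverts \<open>T\<close>, and by symmetry of the root the
  squared norm of the inverse root is the quadratic form of the inverse of \<open>T\<close>. Thus
  bounds on the inverse weights control \<open>gamma_sc\<close>.\<close>

lemma norm_inv_sqrt_on:
  assumes T: "posdef_on (Xc \<phi> N) T" and x: "x \<in> Xc \<phi> N"
  shows "norm (inv_into (Xc \<phi> N) (sqrt_on (Xc \<phi> N) T) x)
           \<le> sqrt (opnorm_on (Xc \<phi> N) (inv_into (Xc \<phi> N) T)) * norm x"
proof -
  let ?S = "Xc \<phi> N"
  let ?R = "sqrt_on ?S T"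
  let ?I = "inv_into ?S ?R"
  have R: "posdef_on ?S ?R" by (rule posdef_on_Xc(2)[OF T])
  note i = linear_on_inv_into[OF R] and sa = selfadj_onD[OF posdef_onD(1)[OF R]]
  have II: "T (?I (?I x)) = x"
    using posdef_on_Xc(3)[OF T, of "?I (?I x)"] i x by simp
  have Iin: "?I x \<in> ?S" "?I (?I x) \<in> ?S" using i x by blast+
  have eq: "inv_into ?S T x = ?I (?I x)"
    using linear_on_inv_into(4)[OF T Iin(2)] II by simp
  have "(norm (?I x))\<^sup>2 = ?R (?I (?I x)) \<bullet> ?I x" using i(3)[OF Iin(1)] by (simp add: power2_norm_eq_inner)
  also have "\<dots> = ?I (?I x) \<bullet> x" using sa(3)[OF Iin(2,1)] i(3)[OF x] by simp
  also have "\<dots> \<le> norm (inv_into ?S T x) * norm x" unfolding eq by (rule norm_cauchy_schwarz)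
  also have "\<dots> \<le> opnorm_on ?S (inv_into ?S T) * norm x * norm x"
    using linear_on_inv_into(1)[OF T] x by (intro mult_right_mono linear_on_Xc_opnorm) auto
  finally have "norm (?I x) \<le> sqrt (opnorm_on ?S (inv_into ?S T) * (norm x)\<^sup>2)"
    by (intro real_le_rsqrt) (simp add: power2_eq_square mult.assoc)
  then show ?thesis by (simp add: real_sqrt_mult)
qed

text \<open>The supremum is real-valued, so boundedness has to come first. The bound by
  \<open>norm L\<close> yields uniformity in \<open>N\<close>, the sign permits squaring, and the
  pointwise estimate is the form used for dissipation.\<close>

lemma gamma_cs_bounds:
  fixes L :: "'a \<Rightarrow>\<^sub>L 'a"
  assumes T: "posdef_on (Xc \<phi> N) T"
  shows "0 \<le> gamma_cs \<phi> L N T"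
    and "gamma_cs \<phi> L N T \<le> sqrt (opnorm_on (Xc \<phi> N) T) * norm L"
    and "\<And>x. x \<in> Xs \<phi> N \<Longrightarrow> norm (sqrt_on (Xc \<phi> N) T (Pr \<phi> N (L x))) \<le> gamma_cs \<phi> L N T * norm x"
proof -
  let ?f = "\<lambda>x. sqrt_on (Xc \<phi> N) T (Pr \<phi> N (L (Qr \<phi> N x)))"
  let ?K = "sqrt (opnorm_on (Xc \<phi> N) T) * norm L"
  obtain K where K: "0 \<le> K" "\<And>x. x \<in> Xc \<phi> N \<Longrightarrow> norm (T x) \<le> K * norm x"
    using linear_on_Xc_bounded[OF selfadj_onD(1)[OF posdef_onD(1)[OF T]]] by blast
  then have nn: "0 \<le> opnorm_on (Xc \<phi> N) T"
    using subspace_0[OF subspace_Xc] by (intro opnorm_on_nonneg bdd_above_opnorm_on) auto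
  have b: "norm (?f x) \<le> ?K * norm x" for x
  proof -
    have "norm (?f x) \<le> sqrt (opnorm_on (Xc \<phi> N) T) * norm (Pr \<phi> N (L (Qr \<phi> N x)))"
      by (rule norm_sqrt_on(2)[OF T Pr_in_Xc])
    also have "\<dots> \<le> sqrt (opnorm_on (Xc \<phi> N) T) * (norm L * norm x)"
      using nn by (intro mult_left_mono order_trans[OF norm_Pr_le] order_trans[OF norm_blinfun] norm_Qr_le) auto
    finally show ?thesis by (simp add: mult.assoc)
  qed
  have K0: "0 \<le> ?K" using nn by simp
  have ne: "Xs \<phi> N \<noteq> {}" using subspace_0[OF subspace_Xs] by blast
  have bdd: "bdd_above ((\<lambda>x. norm (?f x) / norm x) ` Xs \<phi> N)"
    by (rule bdd_above_opnorm_on[OF b K0])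
  show "0 \<le> gamma_cs \<phi> L N T"
    unfolding gamma_cs_def by (rule opnorm_on_nonneg[OF bdd ne])
  show "gamma_cs \<phi> L N T \<le> ?K"
    unfolding gamma_cs_def by (rule opnorm_on_le[OF b K0 ne])
  show "norm (sqrt_on (Xc \<phi> N) T (Pr \<phi> N (L x))) \<le> gamma_cs \<phi> L N T * norm x" if "x \<in> Xs \<phi> N" for x
    using opnorm_on_bound[OF bdd that] b[of 0] that unfolding gamma_cs_def by (simp add: Qr_Xs)
qed

lemma gamma_sc_bounds:
  fixes L :: "'a \<Rightarrow>\<^sub>L 'a"
  assumes T: "posdef_on (Xc \<phi> N) T"
  shows "0 \<le> gamma_sc \<phi> L N T"
    and "gamma_sc \<phi> L N T \<le> sqrt (opnorm_on (Xc \<phi> N) (inv_into (Xc \<phi> N) T)) * norm L"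
    and "\<And>x. x \<in> Xc \<phi> N \<Longrightarrow> norm (Qr \<phi> N (L x)) \<le> gamma_sc \<phi> L N T * norm (sqrt_on (Xc \<phi> N) T x)"
proof -
  let ?R = "sqrt_on (Xc \<phi> N) T"
  let ?I = "inv_into (Xc \<phi> N) ?R"
  let ?f = "\<lambda>x. Qr \<phi> N (L (Pr \<phi> N (?I x)))"
  let ?K = "sqrt (opnorm_on (Xc \<phi> N) (inv_into (Xc \<phi> N) T)) * norm L"
  note R = posdef_on_Xc(2)[OF T]
  obtain K where K: "0 \<le> K" "\<And>x. x \<in> Xc \<phi> N \<Longrightarrow> norm (inv_into (Xc \<phi> N) T x) \<le> K * norm x"
    using linear_on_Xc_bounded[OF linear_on_inv_into(1)[OF T]] by blast
  then have nn: "0 \<le> opnorm_on (Xc \<phi> N) (inv_into (Xc \<phi> N) T)"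
    using subspace_0[OF subspace_Xc] by (intro opnorm_on_nonneg bdd_above_opnorm_on) auto
  have b: "norm (?f x) \<le> ?K * norm x" if "x \<in> Xc \<phi> N" for x
  proof -
    have "norm (?f x) \<le> norm L * norm (?I x)"
      by (intro order_trans[OF norm_Qr_le] order_trans[OF norm_blinfun] mult_left_mono norm_Pr_le) auto
    also have "\<dots> \<le> norm L * (sqrt (opnorm_on (Xc \<phi> N) (inv_into (Xc \<phi> N) T)) * norm x)"
      by (intro mult_left_mono norm_inv_sqrt_on T that) auto
    finally show ?thesis by (simp add: mult_ac)
  qed
  have K0: "0 \<le> ?K" using nn by simp
  have ne: "Xc \<phi> N \<noteq> {}" using subspace_0[OF subspace_Xc] by blast
  have bdd: "bdd_above ((\<lambda>x. norm (?f x) / norm x) ` Xc \<phi> N)"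
    by (rule bdd_above_opnorm_on[OF b K0])
  show "0 \<le> gamma_sc \<phi> L N T"
    unfolding gamma_sc_def by (rule opnorm_on_nonneg[OF bdd ne])
  show "gamma_sc \<phi> L N T \<le> ?K"
    unfolding gamma_sc_def by (rule opnorm_on_le[OF b K0 ne])
  show "norm (Qr \<phi> N (L x)) \<le> gamma_sc \<phi> L N T * norm (?R x)" if x: "x \<in> Xc \<phi> N" for x
  proof -
    have Rx: "?R x \<in> Xc \<phi> N" using selfadj_onD(2)[OF posdef_onD(1)[OF R] x] .
    \<comment> \<open>Inserting \<open>?R x\<close> cancels the inverse root:
      \<open>gamma_sc\<close> measures the coupling relative to the weighted norm of the critical
      component.\<close>
    have "norm (?f (?R x)) \<le> gamma_sc \<phi> L N T * norm (?R x)"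
      using opnorm_on_bound[OF bdd Rx] b[of 0] subspace_0[OF subspace_Xc] unfolding gamma_sc_def by simp
    then show ?thesis using linear_on_inv_into(4)[OF R x] x by (simp add: Pr_Xc)
  qed
qed

text \<open>The bound by \<open>norm L\<close> does not depend on \<open>N\<close>, so
  \<open>mu_s\<close> inherits the growth of \<open>lam (N + 1)\<close>. The homogeneous estimate
  follows from the unit sphere by scaling.\<close>

lemma ell_s_bounds:
  fixes L :: "'a \<Rightarrow>\<^sub>L 'a"
  shows "ell_s \<phi> L N \<le> norm L"
    and "\<And>x. x \<in> Xs \<phi> N \<Longrightarrow> - (L x \<bullet> x) \<le> ell_s \<phi> L N * (norm x)\<^sup>2"
proof -
  let ?f = "\<lambda>x. (- Qr \<phi> N (L (Qr \<phi> N x))) \<bullet> x"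
  let ?A = "{x \<in> Xs \<phi> N. norm x = 1}"
  have f: "?f x = - (L x \<bullet> x)" if "x \<in> Xs \<phi> N" for x
    using Xs_inner_Qr[OF that, of "L x"] that by (simp add: Qr_Xs inner_commute)
  have b: "?f x \<le> norm L" if "x \<in> ?A" for x
  proof -
    have "- (L x \<bullet> x) \<le> norm (L x) * norm x" using norm_cauchy_schwarz[of "- L x" x] by simp
    also have "\<dots> \<le> norm L * norm x * norm x" by (intro mult_right_mono norm_blinfun) auto
    finally show ?thesis using that f[of x] by simp
  qed
  \<comment> \<open>The next basis vector shows that the supremum is taken over a nonempty
    set.\<close>
  have "\<phi> (Suc N) \<in> ?A"
    using inner_basis[of "Suc N" "Suc N"] by (auto simp: Xs_iff inner_basis norm_eq_sqrt_inner)
  then have ne: "?A \<noteq> {}" by blast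
  show "ell_s \<phi> L N \<le> norm L"
    unfolding ell_s_def by (rule cSUP_least[OF ne b])
  have bdd: "bdd_above (?f ` ?A)" using b by (intro bdd_aboveI2)
  show "- (L x \<bullet> x) \<le> ell_s \<phi> L N * (norm x)\<^sup>2" if x: "x \<in> Xs \<phi> N" for x
  proof (cases "x = 0")
    case False
    let ?y = "(1 / norm x) *\<^sub>R x"
    have y: "?y \<in> ?A" using False x subspace_scale[OF subspace_Xs] by simp
    have "?f ?y \<le> ell_s \<phi> L N" unfolding ell_s_def by (rule cSUP_upper[OF y bdd])
    moreover have "?f ?y = - (L x \<bullet> x) / (norm x)\<^sup>2"
      using y f[of ?y] by (simp add: blinfun.scaleR_right power2_eq_square)
    ultimately have "- (L x \<bullet> x) / (norm x)\<^sup>2 \<le> ell_s \<phi> L N" by simp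
    then show ?thesis using False by (subst (asm) pos_divide_le_eq) auto
  qed simp
qed

end

section \<open>Solutions in coordinates\<close>

lemma exp_diff_le:
  fixes p q :: real
  assumes "p \<le> q" shows "exp q - exp p \<le> exp q * (q - p)"
proof -
  have "exp q * (1 + (p - q)) \<le> exp q * exp (p - q)"
    by (intro mult_left_mono exp_ge_add_one_self) auto
  then show ?thesis by (simp add: exp_add[symmetric] algebra_simps)
qed

text \<open>A weak form shared by both solution types: on a coefficient the unbounded operator is
  multiplication by an eigenvalue, so membership in its domain never arises. Norm continuity of
  \<open>z\<close> is kept for compactness of trajectories. The exceptional null set may depend on
  \<open>j\<close>.\<close>

definition coefficient_solution ::
  "(nat \<Rightarrow> 'a::real_inner) \<Rightarrow> (nat \<Rightarrow> real) \<Rightarrow> ('a \<Rightarrow>\<^sub>L 'a) \<Rightarrow> (real \<Rightarrow> real) \<Rightarrow> real \<Rightarrow> (real \<Rightarrow> 'a) \<Rightarrow> bool" where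
  "coefficient_solution \<phi> lam L d t0 z \<longleftrightarrow> continuous_on {t0..} z \<and>
     (\<forall>j\<ge>1. (\<forall>a b. t0 < a \<and> a \<le> b \<longrightarrow> abs_continuous_on a b (\<lambda>t. z t \<bullet> \<phi> j)) \<and>
        (AE t in lebesgue. t0 < t \<longrightarrow>
           ((\<lambda>t. z t \<bullet> \<phi> j) has_real_derivative (- (d t * lam j * (z t \<bullet> \<phi> j)) - L (z t) \<bullet> \<phi> j)) (at t)))"

lemma AE_lebesgue_negligible:
  assumes "AE t in lebesgue. P t"
  obtains E where "negligible E" "\<And>t::real. t \<notin> E \<Longrightarrow> P t"
proof -
  obtain E where "E \<in> null_sets lebesgue" "{x \<in> space lebesgue. \<not> P x} \<subseteq> E"
    using assms unfolding eventually_ae_filter by blast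
  then show thesis by (intro that[of E]) (auto simp: negligible_iff_null_sets)
qed

lemma negligible_AE_lebesgue:
  assumes "negligible E" "\<And>t::real. t \<notin> E \<Longrightarrow> P t"
  shows "AE t in lebesgue. P t"
  using assms by (intro AE_I'[of E]) (auto simp: negligible_iff_null_sets)

locale diagonal_operator = orthonormal \<phi>
  for \<phi> :: "nat \<Rightarrow> 'a::{real_inner, complete_space}" +
  fixes D :: "'a set" and A :: "'a \<Rightarrow> 'a" and lam :: "nat \<Rightarrow> real"
  assumes eig: "eigenbasis D A \<phi> lam" and self_adjoint: "selfadj_unbounded D A"
begin

lemma basis_in_D: "1 \<le> j \<Longrightarrow> \<phi> j \<in> D"
  and A_basis: "1 \<le> j \<Longrightarrow> A (\<phi> j) = lam j *\<^sub>R \<phi> j"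
  using eig by (auto simp: eigenbasis_def)

lemma lam_mono:
  assumes "1 \<le> i" "i \<le> j" shows "lam i \<le> lam j"
  using assms(2)
proof (induction j rule: dec_induct)
  case (step j)
  then have "lam j \<le> lam (Suc j)" using eig assms(1) by (simp add: eigenbasis_def)
  then show ?case using step by simp
qed simp

lemma lam_pos: "1 \<le> j \<Longrightarrow> 0 < lam j"
  using lam_mono[of 1 j] eig by (auto simp: eigenbasis_def)

lemma linear_A: "linear_on_sub D A"
  using self_adjoint by (simp add: selfadj_unbounded_def)

lemma A_inner_basis: "\<lbrakk>x \<in> D; 1 \<le> j\<rbrakk> \<Longrightarrow> A x \<bullet> \<phi> j = lam j * (x \<bullet> \<phi> j)"
proof -
  assume x: "x \<in> D" and j: "1 \<le> j"
  have "\<forall>x\<in>D. A x \<bullet> \<phi> j = x \<bullet> A (\<phi> j)"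
    using self_adjoint basis_in_D[OF j] unfolding selfadj_unbounded_def by blast
  then show ?thesis using x by (simp add: A_basis[OF j])
qed

lemma Xc_in_D: "x \<in> Xc \<phi> n \<Longrightarrow> x \<in> D"
proof -
  assume x: "x \<in> Xc \<phi> n"
  have "Xc \<phi> n \<subseteq> D"
    unfolding Xc_def using linear_on_subD(1)[OF linear_A] basis_in_D by (intro span_minimal) auto
  then show "x \<in> D" using x by blast
qed

lemma A_sum_basis: "A (\<Sum>j=1..n. c j *\<^sub>R \<phi> j) = (\<Sum>j=1..n. (c j * lam j) *\<^sub>R \<phi> j)"
proof (induction n)
  case 0
  show ?case using linear_on_subD(4)[OF linear_A] by simp
next
  case (Suc n)
  note l = linear_on_subD[OF linear_A]
  have "(\<Sum>j=1..n. c j *\<^sub>R \<phi> j) \<in> D" by (rule Xc_in_D[OF sum_basis_in_Xc])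
  moreover have "\<phi> (Suc n) \<in> D" by (simp add: basis_in_D)
  ultimately have "A ((\<Sum>j=1..n. c j *\<^sub>R \<phi> j) + c (Suc n) *\<^sub>R \<phi> (Suc n))
     = A (\<Sum>j=1..n. c j *\<^sub>R \<phi> j) + c (Suc n) *\<^sub>R A (\<phi> (Suc n))"
    using l(2,3) subspace_scale[OF l(1)] by simp
  then show ?case using Suc.IH by (simp add: A_basis)
qed

lemma strong_imp_coefficient_solution:
  assumes "strong_solution D A L d t0 z"
  shows "coefficient_solution \<phi> lam L d t0 z"
  unfolding coefficient_solution_def
proof (intro conjI allI impI)
  show "continuous_on {t0..} z" using assms by (simp add: strong_solution_def)
  fix j :: nat assume j: "1 \<le> j"
  have nj: "norm (\<phi> j) = 1" using inner_basis[OF j j] by (simp add: norm_eq_sqrt_inner)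
  show "abs_continuous_on a b (\<lambda>t. z t \<bullet> \<phi> j)" if "t0 < a \<and> a \<le> b" for a b
  proof (rule abs_continuous_on_mono_variation[where K=1])
    show "abs_continuous_on a b z" using assms that by (simp add: strong_solution_def)
    fix u v :: real assume "u \<le> v"
    have "\<bar>(z v - z u) \<bullet> \<phi> j\<bar> \<le> norm (z v - z u)"
      using Cauchy_Schwarz_ineq2[of "z v - z u" "\<phi> j"] nj by simp
    then show "norm (z v \<bullet> \<phi> j - z u \<bullet> \<phi> j) \<le> 1 * (v - u + norm (z v - z u))"
      using \<open>u \<le> v\<close> by (simp add: inner_diff_left)
  qed simp
  have "AE t in lebesgue. t0 < t \<longrightarrow>
        z t \<in> D \<and> (z has_vector_derivative (- (d t *\<^sub>R A (z t)) - L (z t))) (at t)"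
    using assms by (simp add: strong_solution_def)
  then show "AE t in lebesgue. t0 < t \<longrightarrow>
      ((\<lambda>t. z t \<bullet> \<phi> j) has_real_derivative (- (d t * lam j * (z t \<bullet> \<phi> j)) - L (z t) \<bullet> \<phi> j)) (at t)"
  proof eventually_elim
    case (elim t)
    show ?case
    proof
      assume "t0 < t"
      then have zt: "z t \<in> D" and der: "(z has_vector_derivative (- (d t *\<^sub>R A (z t)) - L (z t))) (at t)"
        using elim by auto
      have "((\<lambda>t. z t \<bullet> \<phi> j) has_vector_derivative ((- (d t *\<^sub>R A (z t)) - L (z t)) \<bullet> \<phi> j)) (at t)"
        by (rule bounded_linear.has_vector_derivative[OF bounded_linear_inner_left der])
      then show "((\<lambda>t. z t \<bullet> \<phi> j) has_real_derivative (- (d t * lam j * (z t \<bullet> \<phi> j)) - L (z t) \<bullet> \<phi> j)) (at t)"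
        using A_inner_basis[OF zt j]
        by (simp add: has_real_derivative_iff_has_vector_derivative inner_diff_left mult.assoc)
    qed
  qed
qed

text \<open>Pairing the integral equation with \<open>\<phi> j\<close> gives a scalar variation of
  constants formula. In terms of the clock \<open>\<Theta>\<close>, the integral of
  \<open>d\<close>, each coefficient is \<open>E t * W t\<close>, where \<open>E\<close> is
  Lipschitz and differentiable almost everywhere and \<open>W\<close> is a constant minus the
  integral of a continuous function.\<close>

lemma mild_imp_coefficient_solution:
  assumes adm: "admissible dm dp d" and dm: "0 < dm" and t0: "0 \<le> t0"
    and mild: "mild_solution \<phi> lam L d t0 z"
  shows "coefficient_solution \<phi> lam L d t0 z"
proof -
  obtain U where U: "evolution_family \<phi> lam L d U" and zU: "\<And>t. t0 \<le> t \<Longrightarrow> z t = U t t0 (z t0)"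
    using mild unfolding mild_solution_def by blast
  \<comment> \<open>Nothing is known about \<open>d\<close> at negative times, while the
    differentiation theorem asks for integrability on every interval; hence the extension by
    zero.\<close>
  define d' where "d' t = (if t \<in> {0..} then d t else 0)" for t
  have dbound: "dm \<le> d t" "d t \<le> dp" if "0 \<le> t" for t using adm that by (auto simp: admissible_def)
  have dp: "0 < dp" using dbound[of 0] dm by simp
  have d'bound: "0 \<le> d' t" "d' t \<le> dp" for t using dbound[of t] dm dp by (auto simp: d'_def)
  have d'int: "d' integrable_on {a..b}" for a b
  proof -
    have "d integrable_on {max 0 a..b}"
    proof (rule measurable_bounded_by_integrable_imp_integrable)
      show "d \<in> borel_measurable (lebesgue_on {max 0 a..b})"
        using adm by (auto simp: admissible_def intro: measurable_restrict_mono[of d _ "{0..}"])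
      show "(\<lambda>_. dp) integrable_on {max 0 a..b}" by (rule integrable_const_ivl)
      show "norm (d x) \<le> dp" if "x \<in> {max 0 a..b}" for x using dbound[of x] dm that by auto
    qed auto
    moreover have "{0..} \<inter> {a..b} = {max 0 a..b}" by auto
    ultimately show ?thesis unfolding d'_def integrable_restrict_Int by simp
  qed
  define \<Theta> where "\<Theta> t = integral {t0..t} d'" for t
  have \<Theta>diff: "integral {r..t} d = \<Theta> t - \<Theta> r" if "t0 \<le> r" "r \<le> t" for r t
  proof -
    have "integral {r..t} d = integral {r..t} d'"
      using t0 that by (intro integral_cong) (simp add: d'_def)
    also have "\<dots> = \<Theta> t - \<Theta> r"
      using Henstock_Kurzweil_Integration.integral_combine[of t0 r t d'] that d'int by (simp add: \<Theta>_def)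
    finally show ?thesis .
  qed
  have \<Theta>le: "0 \<le> \<Theta> t - \<Theta> r \<and> \<Theta> t - \<Theta> r \<le> dp * (t - r)" if "t0 \<le> r" "r \<le> t" for r t
  proof -
    have eq: "\<Theta> t - \<Theta> r = integral {r..t} d'"
      using Henstock_Kurzweil_Integration.integral_combine[of t0 r t d'] that d'int by (simp add: \<Theta>_def)
    have "integral {r..t} d' \<le> integral {r..t} (\<lambda>_. dp)"
      using d'int d'bound by (intro integral_le integrable_const_ivl) auto
    moreover have "0 \<le> integral {r..t} d'"
      using d'int d'bound by (intro integral_nonneg) auto
    ultimately show ?thesis using that unfolding eq by (simp add: mult.commute)
  qed
  have \<Theta>0: "\<Theta> t0 = 0" by (simp add: \<Theta>_def)
  have \<Theta>cont: "continuous_on {t0..t} \<Theta>" for t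
    unfolding \<Theta>_def[abs_def] by (rule indefinite_integral_continuous_1[OF d'int])
  have Ucont: "continuous_on {t0..} (\<lambda>t. U t t0 (z t0))"
  proof -
    have "continuous_on {(t, s). 0 \<le> s \<and> s \<le> t} (\<lambda>(t, s). U t s (z t0))"
      using U by (simp add: evolution_family_def)
    then have "continuous_on {t0..} ((\<lambda>(t, s). U t s (z t0)) \<circ> (\<lambda>t. (t, t0)))"
      using t0 by (intro continuous_on_compose continuous_intros) (auto elim: continuous_on_subset)
    then show ?thesis by (simp add: o_def)
  qed
  then have zcont: "continuous_on {t0..} z"
    by (rule continuous_on_eq) (simp add: zU[symmetric])
  have coef: "abs_continuous_on a b (\<lambda>t. z t \<bullet> \<phi> j)" "AE t in lebesgue. t0 < t \<longrightarrow>
      ((\<lambda>t. z t \<bullet> \<phi> j) has_real_derivative (- (d t * lam j * (z t \<bullet> \<phi> j)) - L (z t) \<bullet> \<phi> j)) (at t)"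
    if j: "1 \<le> j" and ab: "t0 < a" "a \<le> b" for j a b
  proof -
    have l0: "0 < lam j" by (rule lam_pos[OF j])
    define x where "x = z t0 \<bullet> \<phi> j"
    define g where "g r = exp (lam j * \<Theta> r) * (L (z r) \<bullet> \<phi> j)" for r
    define W where "W t = x - integral {t0..t} g" for t
    define E where "E t = exp (- (lam j * \<Theta> t))" for t
    have gcont: "continuous_on {t0..t} g" for t
      unfolding g_def[abs_def]
      by (intro continuous_intros \<Theta>cont blinfun.continuous_on continuous_on_subset[OF zcont]) auto
    have gint: "g integrable_on {u..v}" if "t0 \<le> u" for u v
      using that by (intro integrable_continuous_real continuous_on_subset[OF gcont[of v]]) auto
    \<comment> \<open>The kernel \<open>exp (- (\<Theta> t - \<Theta> r) * lam j)\<close> factors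
      into \<open>E t\<close> and a function of \<open>r\<close>, so \<open>t\<close> leaves the
      integrand.\<close>
    have zj: "z t \<bullet> \<phi> j = E t * W t" if t: "t0 \<le> t" for t
    proof -
      let ?f = "\<lambda>r. diag_evolution \<phi> lam d t r (L (U r t0 (z t0)))"
      have coefS: "diag_evolution \<phi> lam d t r y \<bullet> \<phi> j = exp (- (\<Theta> t - \<Theta> r) * lam j) * (y \<bullet> \<phi> j)"
        if r: "t0 \<le> r" "r \<le> t" for r y
        unfolding diag_evolution_def \<Theta>diff[OF r]
        using \<Theta>le[OF r] lam_pos j by (intro diag_semigroup_coefficient) (auto simp: less_imp_le)
      have "(?f has_integral (diag_evolution \<phi> lam d t t0 (z t0) - U t t0 (z t0))) {t0..t}"
        using U t t0 by (simp add: evolution_family_def)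
      then have "((\<lambda>r. ?f r \<bullet> \<phi> j) has_integral ((diag_evolution \<phi> lam d t t0 (z t0) - U t t0 (z t0)) \<bullet> \<phi> j)) {t0..t}"
        by (drule_tac has_integral_linear[OF _ bounded_linear_inner_left[of "\<phi> j"]]) (simp add: o_def)
      moreover have "?f r \<bullet> \<phi> j = E t * g r" if "r \<in> {t0..t}" for r
        using coefS[of r "L (U r t0 (z t0))"] zU[of r] that
        by (simp add: E_def g_def mult_exp_exp[symmetric] algebra_simps exp_add[symmetric])
      ultimately have "((\<lambda>r. E t * g r) has_integral ((diag_evolution \<phi> lam d t t0 (z t0) - U t t0 (z t0)) \<bullet> \<phi> j)) {t0..t}"
        using has_integral_cong[of "{t0..t}" "\<lambda>r. ?f r \<bullet> \<phi> j" "\<lambda>r. E t * g r"] by blast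
      moreover have "((\<lambda>r. E t * g r) has_integral (E t * integral {t0..t} g)) {t0..t}"
        using gint[of t0 t] by (intro has_integral_mult_right) (simp add: has_integral_integral)
      ultimately have "(diag_evolution \<phi> lam d t t0 (z t0) - U t t0 (z t0)) \<bullet> \<phi> j = E t * integral {t0..t} g"
        by (rule has_integral_unique)
      then show ?thesis
        using coefS[of t0 "z t0"] t zU[OF t] \<Theta>0
        by (simp add: inner_diff_left E_def W_def x_def algebra_simps)
    qed
    have E01: "0 < E t" "E t \<le> 1" if "t0 \<le> t" for t
      using \<Theta>le[of t0 t] \<Theta>0 that l0 by (auto simp: E_def)
    show "abs_continuous_on a b (\<lambda>t. z t \<bullet> \<phi> j)"
    proof -
      have "compact (g ` {t0..b})" by (intro compact_continuous_image gcont compact_Icc)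
      then obtain G where G: "G > 0" "\<And>r. r \<in> {t0..b} \<Longrightarrow> \<bar>g r\<bar> \<le> G"
        using compact_imp_bounded bounded_pos by (metis imageI real_norm_def)
      have Ileq: "\<bar>integral {u..v} g\<bar> \<le> G * (v - u)" if "t0 \<le> u" "u \<le> v" "v \<le> b" for u v
        using integral_bound[of u v g G] that G(2) continuous_on_subset[OF gcont[of v], of "{u..v}"] by auto
      \<comment> \<open>Lipschitz constant of the product: \<open>E\<close> is at most one and
        \<open>W\<close> has constant \<open>G\<close>; \<open>W\<close> is bounded by the sum in
        parentheses and \<open>E\<close> has constant \<open>lam j * dp\<close>.\<close>
      define K where "K = G + (\<bar>x\<bar> + G * (b - t0)) * (lam j * dp)"
      have K: "0 \<le> K" using G(1) ab l0 dp by (auto simp: K_def)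
      show ?thesis
      proof (rule abs_continuous_on_lipschitz[OF K])
        fix u v assume uv: "a \<le> u" "u \<le> v" "v \<le> b"
        have u0: "t0 \<le> u" "t0 \<le> v" using uv ab by auto
        have Wuv: "\<bar>W v - W u\<bar> \<le> G * (v - u)"
          using Ileq[of u v] Henstock_Kurzweil_Integration.integral_combine[of t0 u v g] gint[of t0 v] uv u0
          by (simp add: W_def)
        have "\<bar>integral {t0..u} g\<bar> \<le> G * (u - t0)" using Ileq[of t0 u] uv u0 by simp
        also have "\<dots> \<le> G * (b - t0)" using uv G(1) by simp
        finally have Wu: "\<bar>W u\<bar> \<le> \<bar>x\<bar> + G * (b - t0)" unfolding W_def by linarith
        have "E u - E v \<le> E u * (lam j * (\<Theta> v - \<Theta> u))"
          using exp_diff_le[of "- (lam j * \<Theta> v)" "- (lam j * \<Theta> u)"] \<Theta>le[OF u0(1) uv(2)] l0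
          by (simp add: E_def algebra_simps)
        also have "\<dots> \<le> 1 * (lam j * (dp * (v - u)))"
          using E01[OF u0(1)] \<Theta>le[OF u0(1) uv(2)] l0 by (intro mult_mono mult_left_mono) auto
        finally have "E u - E v \<le> lam j * dp * (v - u)" by simp
        moreover have "E v \<le> E u" using \<Theta>le[OF u0(1) uv(2)] l0 by (simp add: E_def)
        ultimately have Euv: "\<bar>E v - E u\<bar> \<le> lam j * dp * (v - u)" by simp
        have "E v * W v - E u * W u = E v * (W v - W u) + W u * (E v - E u)" by (simp add: algebra_simps)
        also have "\<bar>\<dots>\<bar> \<le> E v * \<bar>W v - W u\<bar> + \<bar>W u\<bar> * \<bar>E v - E u\<bar>"
          using E01(1)[OF u0(2)] by (intro order_trans[OF abs_triangle_ineq]) (simp add: abs_mult)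
        also have "\<dots> \<le> 1 * (G * (v - u)) + (\<bar>x\<bar> + G * (b - t0)) * (lam j * dp * (v - u))"
          using E01[OF u0(2)] Wuv Wu Euv by (intro add_mono mult_mono) auto
        also have "\<dots> = K * (v - u)" by (simp add: K_def algebra_simps)
        finally show "norm (z v \<bullet> \<phi> j - z u \<bullet> \<phi> j) \<le> K * (v - u)" using zj u0 by simp
      qed
    qed
    obtain S where S: "negligible S"
      "\<And>t. \<lbrakk>t \<notin> S; t0 < t\<rbrakk> \<Longrightarrow> (\<Theta> has_real_derivative d' t) (at t)"
      unfolding \<Theta>_def[abs_def]
      using indefinite_integral_has_real_derivative_ae[of d' t0] d'int by blast
    show "AE t in lebesgue. t0 < t \<longrightarrow>
      ((\<lambda>t. z t \<bullet> \<phi> j) has_real_derivative (- (d t * lam j * (z t \<bullet> \<phi> j)) - L (z t) \<bullet> \<phi> j)) (at t)"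
    proof (rule negligible_AE_lebesgue[OF S(1)], rule impI)
      fix t assume t: "t \<notin> S" "t0 < t"
      have d\<Theta>: "(\<Theta> has_real_derivative d t) (at t)"
        using S(2)[OF t] t(2) t0 by (simp add: d'_def)
      have "((\<lambda>x. integral {t0..x} g) has_real_derivative g t) (at t within {t0..t + 1})"
        using t(2) by (intro integral_has_real_derivative gcont) auto
      then have dI: "((\<lambda>x. integral {t0..x} g) has_real_derivative g t) (at t)"
        using t(2) by (simp add: at_within_Icc_at)
      have "((\<lambda>t. E t * W t) has_real_derivative (- (d t * lam j * (E t * W t)) - E t * g t)) (at t)"
        unfolding E_def W_def
        by (rule derivative_eq_intros d\<Theta> dI refl)+ (simp add: algebra_simps)
      moreover have "E t * g t = L (z t) \<bullet> \<phi> j"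
        by (simp add: E_def g_def mult.assoc[symmetric] exp_add[symmetric])
      ultimately have "((\<lambda>t. E t * W t) has_real_derivative (- (d t * lam j * (z t \<bullet> \<phi> j)) - L (z t) \<bullet> \<phi> j)) (at t)"
        using zj[of t] t by simp
      then show "((\<lambda>t. z t \<bullet> \<phi> j) has_real_derivative (- (d t * lam j * (z t \<bullet> \<phi> j)) - L (z t) \<bullet> \<phi> j)) (at t)"
        by (rule has_field_derivative_transform_within_open[where S="{t0<..}"]) (use zj t in auto)
    qed
  qed
  \<comment> \<open>The almost everywhere part of \<open>coef\<close> does not mention its interval;
    the degenerate one at \<open>t0 + 1\<close> merely discharges the premises.\<close>
  show ?thesis
    unfolding coefficient_solution_def using zcont coef(1) coef(2)[of _ "t0 + 1" "t0 + 1"] by auto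
qed

text \<open>
  The truncations \<open>P\<^sub>n z\<close> satisfy the dissipation inequality up to an error caused by \<open>L (z - P\<^sub>n z)\<close>,
  which tends to zero uniformly on compact intervals.
\<close>

lemma lyapunov_decay:
  fixes L :: "'a \<Rightarrow>\<^sub>L 'a"
  assumes sol: "coefficient_solution \<phi> lam L d t0 z" and ab: "t0 < a" "a \<le> b" and w: "0 < w"
    and adm: "\<And>t. t0 < t \<Longrightarrow> d t \<in> {dm..dp}"
    and T: "bounded_linear T" "\<And>x y. T x \<bullet> y = x \<bullet> T y"
    and TX: "\<And>n x. \<lbrakk>N \<le> n; x \<in> Xc \<phi> n\<rbrakk> \<Longrightarrow> T x \<in> Xc \<phi> n"
    and diss: "\<And>n x \<delta>. \<lbrakk>N \<le> n; x \<in> Xc \<phi> n; \<delta> \<in> {dm..dp}\<rbrakk> \<Longrightarrow>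
        T x \<bullet> (- (\<delta> *\<^sub>R A x) - L x) \<le> - w * (T x \<bullet> x)"
  shows "T (z b) \<bullet> z b \<le> exp (- 2 * w * (b - a)) * (T (z a) \<bullet> z a)"
proof -
  have zc: "continuous_on {a..b} z"
    using sol ab by (auto simp: coefficient_solution_def elim: continuous_on_subset)
  have cz: "compact (z ` {a..b})" using zc by (intro compact_continuous_image compact_Icc)
  then obtain \<rho> where \<rho>: "\<rho> > 0" "\<And>t. t \<in> {a..b} \<Longrightarrow> norm (z t) \<le> \<rho>"
    using compact_imp_bounded[OF cz] unfolding bounded_pos by auto
  obtain K where K: "K > 0" "\<And>x. norm (T x) \<le> norm x * K"
    using bounded_linear.pos_bounded[OF T(1)] by blast
  define V where "V x = T x \<bullet> x" for x
  have Vdiff: "\<bar>V x - V y\<bar> \<le> 2 * K * \<rho> * norm (x - y)" if "norm x \<le> \<rho>" "norm y \<le> \<rho>" for x y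
  proof -
    \<comment> \<open>Symmetry of \<open>T\<close> factors this like a difference of
      squares.\<close>
    have "V x - V y = T (x - y) \<bullet> (x + y)"
      using T(2)[of x y] by (simp add: V_def linear_diff[OF bounded_linear.linear[OF T(1)]] inner_diff_left inner_diff_right inner_add_left inner_add_right inner_commute)
    also have "\<bar>\<dots>\<bar> \<le> norm (T (x - y)) * norm (x + y)" by (rule Cauchy_Schwarz_ineq2)
    also have "\<dots> \<le> (norm (x - y) * K) * (\<rho> + \<rho>)"
      using that K by (intro mult_mono norm_triangle_mono) auto
    finally show ?thesis by (simp add: mult_ac)
  qed
  have Vle: "\<bar>V x\<bar> \<le> K * \<rho>\<^sup>2" if "norm x \<le> \<rho>" for x
  proof -
    have "\<bar>V x\<bar> \<le> norm (T x) * norm x" unfolding V_def by (rule Cauchy_Schwarz_ineq2)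
    also have "\<dots> \<le> (\<rho> * K) * \<rho>"
      using that K \<rho>(1) by (intro mult_mono order_trans[OF K(2)]) auto
    finally show ?thesis by (simp add: power2_eq_square mult_ac)
  qed
  have galerkin: "V (Pr \<phi> n (z b)) \<le> exp (- 2 * w * (b - a)) * V (Pr \<phi> n (z a)) + K * \<rho> * norm L * \<epsilon> / w"
    if n: "N \<le> n" and \<epsilon>: "\<epsilon> > 0" "\<And>t. t \<in> {a..b} \<Longrightarrow> norm (Qr \<phi> n (z t)) \<le> \<epsilon>" for n \<epsilon>
  proof -
    define y where "y t = Pr \<phi> n (z t)" for t
    \<comment> \<open>\<open>k\<close> is the equilibrium of the perturbed inequality
      \<open>V' \<le> - 2 * w * V + 2 * w * k\<close>; once it is subtracted, the exponential weight
      makes \<open>f\<close> nonincreasing.\<close>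
    define k where "k = K * \<rho> * norm L * \<epsilon> / w"
    define f where "f t = exp (2 * w * t) * (V (y t) - k)" for t
    have k0: "0 \<le> k" using K \<rho> w \<epsilon> by (simp add: k_def)
    have y\<rho>: "norm (y t) \<le> \<rho>" if "t \<in> {a..b}" for t
      unfolding y_def using norm_Pr_le \<rho>(2)[OF that] by (rule order_trans)
    have yac: "abs_continuous_on a b y"
      unfolding y_def Pr_eq
    proof (rule abs_continuous_on_sum)
      fix j assume j: "j \<in> {1..n}"
      then have nj: "norm (\<phi> j) = 1" using inner_basis[of j j] by (simp add: norm_eq_sqrt_inner)
      have "abs_continuous_on a b (\<lambda>t. z t \<bullet> \<phi> j)"
        using sol j ab by (simp add: coefficient_solution_def)
      then show "abs_continuous_on a b (\<lambda>t. (z t \<bullet> \<phi> j) *\<^sub>R \<phi> j)"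
        by (rule abs_continuous_on_mono_variation[where K=1])
           (auto simp: scaleR_diff_left[symmetric] nj)
    qed
    \<comment> \<open>The first summand pays for increments of \<open>V (y t)\<close> under the
      largest exponential, the second for increments of the exponential under the bound for
      \<open>V (y t) - k\<close>.\<close>
    define M where "M = exp (2 * w * b) * (2 * K * \<rho>) + (K * \<rho>\<^sup>2 + k) * (exp (2 * w * b) * (2 * w))"
    have fac: "abs_continuous_on a b f"
    proof (rule abs_continuous_on_mono_variation[OF yac])
      show "0 \<le> M" using K \<rho> w k0 by (simp add: M_def)
      fix u v assume uv: "a \<le> u" "u \<le> v" "v \<le> b"
      have "exp (2 * w * v) - exp (2 * w * u) \<le> exp (2 * w * v) * (2 * w * v - 2 * w * u)"
        using uv w by (intro exp_diff_le) simp
      also have "\<dots> \<le> exp (2 * w * b) * (2 * w * v - 2 * w * u)"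
        using uv w by (intro mult_right_mono) auto
      also have "\<dots> = exp (2 * w * b) * (2 * w) * (v - u)" by (simp add: algebra_simps)
      finally have E1: "\<bar>exp (2 * w * v) - exp (2 * w * u)\<bar> \<le> exp (2 * w * b) * (2 * w) * (v - u)"
        using uv w by simp
      have E2: "exp (2 * w * v) \<le> exp (2 * w * b)" using uv w by simp
      have V1: "\<bar>V (y v) - V (y u)\<bar> \<le> 2 * K * \<rho> * norm (y v - y u)"
        using uv by (intro Vdiff y\<rho>) auto
      have V2: "\<bar>V (y u) - k\<bar> \<le> K * \<rho>\<^sup>2 + k"
        using Vle[OF y\<rho>[of u]] uv k0 by auto
      have "f v - f u = exp (2 * w * v) * (V (y v) - V (y u)) + (V (y u) - k) * (exp (2 * w * v) - exp (2 * w * u))"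
        by (simp add: f_def algebra_simps)
      also have "\<bar>\<dots>\<bar> \<le> exp (2 * w * v) * \<bar>V (y v) - V (y u)\<bar> + \<bar>V (y u) - k\<bar> * \<bar>exp (2 * w * v) - exp (2 * w * u)\<bar>"
        by (intro order_trans[OF abs_triangle_ineq]) (simp add: abs_mult)
      also have "\<dots> \<le> exp (2 * w * b) * (2 * K * \<rho> * norm (y v - y u)) + (K * \<rho>\<^sup>2 + k) * (exp (2 * w * b) * (2 * w) * (v - u))"
        using K(1) \<rho>(1) k0 by (intro add_mono mult_mono E1 E2 V1 V2) auto
      also have "\<dots> = exp (2 * w * b) * (2 * K * \<rho>) * norm (y v - y u) + (K * \<rho>\<^sup>2 + k) * (exp (2 * w * b) * (2 * w)) * (v - u)"
        by (simp only: mult.assoc)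
      also have "\<dots> \<le> M * norm (y v - y u) + M * (v - u)"
        using uv K(1) \<rho>(1) k0 w by (intro add_mono mult_right_mono) (auto simp: M_def)
      finally show "norm (f v - f u) \<le> M * (v - u + norm (y v - y u))" by (simp add: algebra_simps)
    qed
    \<comment> \<open>Only \<open>n\<close> coefficients occur, so their exceptional sets unite to
      one null set.\<close>
    have "AE t in lebesgue. \<forall>j\<in>{1..n}. t0 < t \<longrightarrow>
       ((\<lambda>t. z t \<bullet> \<phi> j) has_real_derivative (- (d t * lam j * (z t \<bullet> \<phi> j)) - L (z t) \<bullet> \<phi> j)) (at t)"
      using sol by (intro AE_finite_allI) (auto simp: coefficient_solution_def)
    then obtain E where E: "negligible E" "\<And>t j. \<lbrakk>t \<notin> E; j \<in> {1..n}; t0 < t\<rbrakk> \<Longrightarrow>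
       ((\<lambda>t. z t \<bullet> \<phi> j) has_real_derivative (- (d t * lam j * (z t \<bullet> \<phi> j)) - L (z t) \<bullet> \<phi> j)) (at t)"
      by (rule AE_lebesgue_negligible) blast
    have "f b \<le> f a"
    proof (rule abs_continuous_nonincreasing[OF ab(2) fac E(1)])
      fix t assume t: "a < t" "t < b" "t \<notin> E"
      then have t': "t \<in> {a..b}" "t0 < t" using ab by auto
      define h where "h = - (d t *\<^sub>R A (y t)) - Pr \<phi> n (L (z t))"
      have "h = (\<Sum>j=1..n. (- (d t * lam j * (z t \<bullet> \<phi> j)) - L (z t) \<bullet> \<phi> j) *\<^sub>R \<phi> j)"
        unfolding h_def y_def Pr_eq A_sum_basis scaleR_sum_right sum_negf[symmetric] sum_subtractf[symmetric]
        by (intro sum.cong refl) (simp add: scaleR_diff_left mult_ac)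
      moreover have "(y has_vector_derivative (\<Sum>j=1..n. (- (d t * lam j * (z t \<bullet> \<phi> j)) - L (z t) \<bullet> \<phi> j) *\<^sub>R \<phi> j)) (at t)"
        unfolding y_def Pr_eq
      proof (rule has_vector_derivative_sum)
        fix j assume j: "j \<in> {1..n}"
        show "((\<lambda>t. (z t \<bullet> \<phi> j) *\<^sub>R \<phi> j) has_vector_derivative
            (- (d t * lam j * (z t \<bullet> \<phi> j)) - L (z t) \<bullet> \<phi> j) *\<^sub>R \<phi> j) (at t)"
          using E(2)[OF t(3) j t'(2)] unfolding has_real_derivative_iff_has_vector_derivative
          by (rule bounded_linear.has_vector_derivative[OF bounded_linear_scaleR_left])
      qed
      ultimately have yd: "(y has_vector_derivative h) (at t)" by simp
      have Td: "((\<lambda>t. T (y t)) has_vector_derivative T h) (at t)"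
        by (rule bounded_linear.has_vector_derivative[OF T(1) yd])
      have "((\<lambda>t. V (y t)) has_vector_derivative (T (y t) \<bullet> h + T h \<bullet> y t)) (at t)"
        unfolding V_def by (rule bounded_bilinear.has_vector_derivative[OF bounded_bilinear_inner Td yd])
      then have Vd: "((\<lambda>t. V (y t)) has_real_derivative (2 * (T (y t) \<bullet> h))) (at t)"
        using T(2)[of h "y t"] by (simp add: has_real_derivative_iff_has_vector_derivative inner_commute)
      have fd: "(f has_real_derivative (exp (2 * w * t) * (2 * w * (V (y t) - k) + 2 * (T (y t) \<bullet> h)))) (at t)"
        unfolding f_def by (rule derivative_eq_intros Vd refl)+ (simp add: algebra_simps)
      have yX: "y t \<in> Xc \<phi> n" by (simp add: y_def Pr_in_Xc)
      \<comment> \<open>Since \<open>T (y t)\<close> stays in the truncated space, the projection in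
        front of \<open>L\<close> drops out; splitting \<open>z t\<close> at \<open>y t\<close> then
        isolates the defect.\<close>
      have "T (y t) \<bullet> h = T (y t) \<bullet> (- (d t *\<^sub>R A (y t)) - L (y t)) - T (y t) \<bullet> L (Qr \<phi> n (z t))"
        unfolding h_def using Xc_inner_Pr[OF TX[OF n yX], of "L (z t)"]
        by (simp add: y_def Qr_def blinfun.diff_right inner_diff_right)
      also have "\<dots> \<le> - w * V (y t) + K * \<rho> * norm L * \<epsilon>"
      proof -
        have "T (y t) \<bullet> (- (d t *\<^sub>R A (y t)) - L (y t)) \<le> - w * V (y t)"
          unfolding V_def by (rule diss[OF n yX adm[OF t'(2)]])
        moreover have "\<bar>T (y t) \<bullet> L (Qr \<phi> n (z t))\<bar> \<le> K * \<rho> * norm L * \<epsilon>"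
        proof -
          have "\<bar>T (y t) \<bullet> L (Qr \<phi> n (z t))\<bar> \<le> norm (T (y t)) * norm (L (Qr \<phi> n (z t)))"
            by (rule Cauchy_Schwarz_ineq2)
          also have "\<dots> \<le> (\<rho> * K) * (norm L * \<epsilon>)"
            using K(1) \<rho>(1) y\<rho>[OF t'(1)] \<epsilon>(2)[OF t'(1)]
            by (intro mult_mono order_trans[OF K(2)] order_trans[OF norm_blinfun]) auto
          finally show ?thesis by (simp add: mult_ac)
        qed
        ultimately show ?thesis by linarith
      qed
      also have "K * \<rho> * norm L * \<epsilon> = w * k" using w by (simp add: k_def)
      finally have "2 * w * (V (y t) - k) + 2 * (T (y t) \<bullet> h) \<le> 0" by (simp add: algebra_simps)
      then have "exp (2 * w * t) * (2 * w * (V (y t) - k) + 2 * (T (y t) \<bullet> h)) \<le> 0"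
        by (intro mult_nonneg_nonpos) auto
      then show "\<exists>y\<le>0. (f has_real_derivative y) (at t)" using fd by blast
    qed
    then have "V (y b) - k \<le> exp (- 2 * w * (b - a)) * (V (y a) - k)"
      unfolding f_def by (simp add: exp_diff exp_minus field_simps)
    also have "\<dots> \<le> exp (- 2 * w * (b - a)) * V (y a)"
      using k0 by (intro mult_left_mono) auto
    finally show ?thesis unfolding y_def k_def by simp
  qed
  have "V (z b) \<le> exp (- 2 * w * (b - a)) * V (z a)"
  proof (rule field_le_epsilon)
    fix e :: real assume e: "e > 0"
    \<comment> \<open>\<open>C\<close> adds the Galerkin defect and the cost of exchanging
      \<open>z\<close> for its truncation at either endpoint; the exponential, being at most one,
      does not amplify the cost at \<open>a\<close>.\<close>
    define C where "C = K * \<rho> * norm L / w + 2 * K * \<rho> + 2 * K * \<rho>"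
    define \<epsilon> where "\<epsilon> = e / (C + 1)"
    have C: "0 \<le> C" using K \<rho> w by (simp add: C_def)
    then have \<epsilon>: "\<epsilon> > 0" using e by (simp add: \<epsilon>_def)
    obtain n0 where n0: "\<And>m x. \<lbrakk>n0 \<le> m; x \<in> z ` {a..b}\<rbrakk> \<Longrightarrow> norm (Qr \<phi> m x) \<le> \<epsilon>"
      using Pr_uniform_approximation[OF cz \<epsilon>] by blast
    define n where "n = max n0 N"
    have Q: "norm (Qr \<phi> n (z t)) \<le> \<epsilon>" if "t \<in> {a..b}" for t
      using n0[of n "z t"] that by (auto simp: n_def)
    have close: "\<bar>V (z t) - V (Pr \<phi> n (z t))\<bar> \<le> 2 * K * \<rho> * \<epsilon>" if t: "t \<in> {a..b}" for t
    proof -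
      have "\<bar>V (z t) - V (Pr \<phi> n (z t))\<bar> \<le> 2 * K * \<rho> * norm (z t - Pr \<phi> n (z t))"
        using \<rho>(2)[OF t] norm_Pr_le[of n "z t"] by (intro Vdiff) auto
      also have "\<dots> \<le> 2 * K * \<rho> * \<epsilon>"
        using Q[OF t] K \<rho> by (intro mult_left_mono) (auto simp: Qr_def)
      finally show ?thesis .
    qed
    have ex: "exp (- 2 * w * (b - a)) \<le> 1" using w ab by simp
    have "V (z b) \<le> V (Pr \<phi> n (z b)) + 2 * K * \<rho> * \<epsilon>" using close[of b] ab by auto
    also have "V (Pr \<phi> n (z b)) \<le> exp (- 2 * w * (b - a)) * V (Pr \<phi> n (z a)) + K * \<rho> * norm L * \<epsilon> / w"
      by (rule galerkin) (auto simp: n_def \<epsilon> intro: Q[unfolded n_def])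
    also have "exp (- 2 * w * (b - a)) * V (Pr \<phi> n (z a)) \<le> exp (- 2 * w * (b - a)) * (V (z a) + 2 * K * \<rho> * \<epsilon>)"
      using close[of a] ab by (intro mult_left_mono) auto
    also have "\<dots> \<le> exp (- 2 * w * (b - a)) * V (z a) + 2 * K * \<rho> * \<epsilon>"
      using ex K \<rho> \<epsilon> mult_right_mono[OF ex, of "2 * K * \<rho> * \<epsilon>"] by (simp add: distrib_left)
    finally have "V (z b) \<le> exp (- 2 * w * (b - a)) * V (z a) + C * \<epsilon>"
      by (simp add: C_def algebra_simps)
    also have "C * \<epsilon> \<le> e" using C e by (simp add: \<epsilon>_def field_simps)
    finally show "V (z b) \<le> exp (- 2 * w * (b - a)) * V (z a) + e" by simp
  qed
  then show ?thesis by (simp add: V_def)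
qed

end

section \<open>The Lyapunov function\<close>

context orthonormal begin

text \<open>The choice in \<open>adj_on\<close> needs a witness, and the transpose with respect to
  the orthonormal basis is one.\<close>

lemma adj_on_Xc:
  assumes G: "linear_on_sub (Xc \<phi> N) G" and x: "x \<in> Xc \<phi> N" and y: "y \<in> Xc \<phi> N"
  shows "G x \<bullet> y = x \<bullet> adj_on (Xc \<phi> N) G y"
proof -
  let ?T = "\<lambda>y. \<Sum>j=1..N. (G (\<phi> j) \<bullet> y) *\<^sub>R \<phi> j"
  interpret bounded_linear "\<lambda>x. G (Pr \<phi> N x)" by (rule linear_on_Xc_bounded_linear[OF G])
  have "G x \<bullet> y = x \<bullet> ?T y" if x: "x \<in> Xc \<phi> N" for x y
  proof -
    have "G x = G (Pr \<phi> N (\<Sum>j=1..N. (x \<bullet> \<phi> j) *\<^sub>R \<phi> j))" using Xc_expansion[OF x] Pr_Xc[OF x] by simp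
    also have "\<dots> = (\<Sum>j=1..N. (x \<bullet> \<phi> j) *\<^sub>R G (\<phi> j))"
      unfolding sum scaleR by (intro sum.cong refl) (simp add: Pr_Xc basis_in_Xc)
    finally show ?thesis by (simp add: inner_sum_left inner_sum_right mult.commute)
  qed
  then have "?T ` Xc \<phi> N \<subseteq> Xc \<phi> N \<and> (\<forall>x\<in>Xc \<phi> N. \<forall>y\<in>Xc \<phi> N. G x \<bullet> y = x \<bullet> ?T y)"
    by (simp add: image_subset_iff sum_basis_in_Xc)
  then have "adj_on (Xc \<phi> N) G ` Xc \<phi> N \<subseteq> Xc \<phi> N \<and>
      (\<forall>x\<in>Xc \<phi> N. \<forall>y\<in>Xc \<phi> N. G x \<bullet> y = x \<bullet> adj_on (Xc \<phi> N) G y)"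
    unfolding adj_on_def
    by (rule someI[of "\<lambda>T'. T' ` Xc \<phi> N \<subseteq> Xc \<phi> N \<and> (\<forall>x\<in>Xc \<phi> N. \<forall>y\<in>Xc \<phi> N. G x \<bullet> y = x \<bullet> T' y)"])
  then show ?thesis using x y by blast
qed

end

text \<open>
  The witness is \<open>w = (4 \<eta> p s - k\<^sup>2) / (4 \<eta> (p + s))\<close>: it keeps the discriminant condition
  \<open>4 \<eta> (p - w) (s - w) \<ge> k\<^sup>2\<close>, and \<open>w \<le> p s / (p + s) < p\<close>.
\<close>

lemma quadratic_form_margin:
  fixes p s k \<eta> :: real
  assumes "0 < p" "0 < s" "0 < \<eta>" "k\<^sup>2 < 4 * \<eta> * p * s"
  obtains w where "0 < w" "\<And>a b. - p * a\<^sup>2 - \<eta> * s * b\<^sup>2 + k * (a * b) \<le> - w * (a\<^sup>2 + \<eta> * b\<^sup>2)"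
proof -
  define w where "w = (4 * \<eta> * p * s - k\<^sup>2) / (4 * \<eta> * (p + s))"
  have den: "0 < 4 * \<eta> * (p + s)" using assms by simp
  have w0: "0 < w" using assms den by (simp add: w_def)
  have weq: "4 * \<eta> * (p + s) * w = 4 * \<eta> * p * s - k\<^sup>2"
    using nonzero_eq_divide_eq[of "4 * \<eta> * (p + s)" w "4 * \<eta> * p * s - k\<^sup>2"] w_def den
    by (auto simp: mult.commute)
  have "(p + s) * w \<le> p * s"
  proof -
    have "4 * \<eta> * ((p + s) * w) \<le> 4 * \<eta> * (p * s)" using weq by (simp add: mult.assoc)
    then show ?thesis using assms(3) by simp
  qed
  then have pw: "0 < p - w"
  proof -
    have "s * w < (p + s) * w" using assms w0 by simp
    also have "\<dots> \<le> s * p" using \<open>(p + s) * w \<le> p * s\<close> by (simp add: mult.commute)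
    finally show ?thesis using assms(2) by simp
  qed
  show thesis
  proof (rule that[OF w0])
    fix a b :: real
    define \<alpha> \<beta> where "\<alpha> = p - w" and "\<beta> = \<eta> * (s - w)"
    have "4 * \<alpha> * \<beta> - k\<^sup>2 = 4 * \<eta> * w\<^sup>2"
      using weq by (simp add: \<alpha>_def \<beta>_def algebra_simps power2_eq_square)
    then have "0 \<le> (4 * \<alpha> * \<beta> - k\<^sup>2) * b\<^sup>2" using assms by simp
    moreover have "4 * \<alpha> * (\<alpha> * a\<^sup>2 + \<beta> * b\<^sup>2 - k * (a * b)) = (2 * \<alpha> * a - k * b)\<^sup>2 + (4 * \<alpha> * \<beta> - k\<^sup>2) * b\<^sup>2"
      by (simp add: power2_eq_square algebra_simps)
    ultimately have "0 \<le> 4 * \<alpha> * (\<alpha> * a\<^sup>2 + \<beta> * b\<^sup>2 - k * (a * b))" by simp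
    then have "0 \<le> \<alpha> * a\<^sup>2 + \<beta> * b\<^sup>2 - k * (a * b)" using pw by (simp add: \<alpha>_def zero_le_mult_iff)
    then show "- p * a\<^sup>2 - \<eta> * s * b\<^sup>2 + k * (a * b) \<le> - w * (a\<^sup>2 + \<eta> * b\<^sup>2)"
      by (simp add: \<alpha>_def \<beta>_def algebra_simps)
  qed
qed

section \<open>Dissipation on truncations and exponential decay\<close>

context diagonal_operator begin

lemma A_symmetric: "\<lbrakk>x \<in> D; y \<in> D\<rbrakk> \<Longrightarrow> A x \<bullet> y = x \<bullet> A y"
  using self_adjoint unfolding selfadj_unbounded_def by blast

lemma A_in_Xc: "x \<in> Xc \<phi> n \<Longrightarrow> A x \<in> Xc \<phi> n"
  by (metis A_sum_basis Xc_expansion sum_basis_in_Xc)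

text \<open>Membership in \<open>Xc \<phi> n\<close> turns the quadratic form into a finite sum.
  Coordinates up to \<open>N\<close> vanish, and the remaining eigenvalues are at least
  \<open>lam (N + 1)\<close>.\<close>

lemma A_lower_bound:
  assumes q: "q \<in> Xc \<phi> n" "q \<in> Xs \<phi> N"
  shows "lam (N + 1) * (norm q)\<^sup>2 \<le> A q \<bullet> q"
proof -
  let ?c = "\<lambda>j. q \<bullet> \<phi> j"
  have q_eq: "q = (\<Sum>j=1..n. ?c j *\<^sub>R \<phi> j)" using Xc_expansion[OF q(1)] by simp
  have "A q = (\<Sum>j=1..n. (?c j * lam j) *\<^sub>R \<phi> j)"
    using A_sum_basis[of ?c n] q_eq by simp
  then have "A q \<bullet> q = (\<Sum>j=1..n. (?c j * lam j) *\<^sub>R \<phi> j) \<bullet> q" by (rule arg_cong)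
  also have "\<dots> = (\<Sum>j=1..n. lam j * (?c j)\<^sup>2)"
    unfolding inner_sum_left by (intro sum.cong refl) (simp add: power2_eq_square inner_commute)
  finally have Aq: "A q \<bullet> q = (\<Sum>j=1..n. lam j * (?c j)\<^sup>2)" .
  have "(norm q)\<^sup>2 = (\<Sum>j=1..n. (?c j)\<^sup>2)"
    using norm_sq_sum_basis[of "{1..n}" ?c] q_eq by simp
  then have "lam (N + 1) * (norm q)\<^sup>2 = (\<Sum>j=1..n. lam (N + 1) * (?c j)\<^sup>2)"
    by (simp add: sum_distrib_left)
  also have "\<dots> \<le> (\<Sum>j=1..n. lam j * (?c j)\<^sup>2)"
  proof (rule sum_mono)
    fix j assume j: "j \<in> {1..n}"
    show "lam (N + 1) * (?c j)\<^sup>2 \<le> lam j * (?c j)\<^sup>2"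
    proof (cases "j \<le> N")
      case True
      then have "?c j = 0" using q(2) j by (simp add: Xs_iff)
      then show ?thesis by simp
    next
      case False
      then show ?thesis using lam_mono[of "N + 1" j] by (intro mult_right_mono) auto
    qed
  qed
  finally show ?thesis using Aq by simp
qed

lemma linear_Gcc:
  fixes L :: "'a \<Rightarrow>\<^sub>L 'a"
  shows "linear_on_sub (Xc \<phi> N) (Gcc A \<phi> L N \<delta>)"
    and "x \<in> Xc \<phi> N \<Longrightarrow> Gcc A \<phi> L N \<delta> x \<in> Xc \<phi> N"
proof -
  note l = linear_on_subD[OF linear_A]
  show "linear_on_sub (Xc \<phi> N) (Gcc A \<phi> L N \<delta>)"
    unfolding linear_on_sub_def Gcc_def
    using l(2,3) Xc_in_D subspace_Xc
    by (auto simp: linear_add[OF linear_Pr] linear_cmul[OF linear_Pr] blinfun.add_right blinfun.scaleR_right algebra_simps)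
  show "Gcc A \<phi> L N \<delta> x \<in> Xc \<phi> N" if "x \<in> Xc \<phi> N"
    unfolding Gcc_def using A_in_Xc[OF that] Pr_in_Xc subspace_Xc
    by (intro subspace_diff subspace_neg subspace_scale) auto
qed

text \<open>Symmetry of \<open>Pim\<close> and the adjoint relation make both summands of the
  quadratic form equal, which cancels the factor two.\<close>

lemma critical_inequality_inner:
  fixes L :: "'a \<Rightarrow>\<^sub>L 'a"
  assumes Pim: "posdef_on (Xc \<phi> N) Pim" and crit: "critical_inequality A \<phi> L dm dp N Pim \<mu>"
    and \<delta>: "\<delta> \<in> {dm..dp}" and c: "c \<in> Xc \<phi> N"
  shows "Pim c \<bullet> Gcc A \<phi> L N \<delta> c \<le> - \<mu> * (Pim c \<bullet> c)"
proof -
  let ?S = "Xc \<phi> N" and ?G = "Gcc A \<phi> L N \<delta>"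
  note sa = selfadj_onD[OF posdef_onD(1)[OF Pim]]
  have "(Pim (?G c) + adj_on ?S ?G (Pim c)) \<bullet> c \<le> (- (2 * \<mu>) *\<^sub>R Pim c) \<bullet> c"
    using crit \<delta> c by (simp add: critical_inequality_def op_le_on_def)
  moreover have "adj_on ?S ?G (Pim c) \<bullet> c = Pim c \<bullet> ?G c"
    using adj_on_Xc[OF linear_Gcc(1) c sa(2)[OF c], of L \<delta>] by (simp add: inner_commute)
  moreover have "Pim (?G c) \<bullet> c = Pim c \<bullet> ?G c"
    using sa(3)[OF linear_Gcc(2)[OF c] c, of L \<delta>] by (simp add: inner_commute)
  ultimately show ?thesis by (simp add: inner_add_left)
qed

text \<open>The operator whose quadratic form is \<open>V\<close>. For positive definite
  \<open>Pim\<close> it is bounded, symmetric and leaves \<open>Xc \<phi> n\<close> invariant when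
  \<open>N \<le> n\<close>, which is what differentiating \<open>V\<close> along truncations
  requires.\<close>

definition lyapunov_operator :: "nat \<Rightarrow> ('a \<Rightarrow> 'a) \<Rightarrow> real \<Rightarrow> 'a \<Rightarrow> 'a" where
  "lyapunov_operator N Pim \<eta> x = Pim (Pr \<phi> N x) + \<eta> *\<^sub>R Qr \<phi> N x"

lemma lyapunov_operator_properties:
  assumes Pim: "posdef_on (Xc \<phi> N) Pim"
  shows "bounded_linear (lyapunov_operator N Pim \<eta>)"
    and "lyapunov_operator N Pim \<eta> x \<bullet> y = x \<bullet> lyapunov_operator N Pim \<eta> y"
    and "\<lbrakk>N \<le> n; x \<in> Xc \<phi> n\<rbrakk> \<Longrightarrow> lyapunov_operator N Pim \<eta> x \<in> Xc \<phi> n"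
    and "lyapunov_operator N Pim \<eta> x \<bullet> x = Pim (Pr \<phi> N x) \<bullet> Pr \<phi> N x + \<eta> * (norm (Qr \<phi> N x))\<^sup>2"
proof -
  note sa = selfadj_onD[OF posdef_onD(1)[OF Pim]]
  show "bounded_linear (lyapunov_operator N Pim \<eta>)"
    unfolding lyapunov_operator_def[abs_def]
    by (intro bounded_linear_add linear_on_Xc_bounded_linear[OF sa(1)] bounded_linear_const_scaleR bounded_linear_Qr)
  have eq: "lyapunov_operator N Pim \<eta> x \<bullet> y = Pim (Pr \<phi> N x) \<bullet> Pr \<phi> N y + \<eta> * (Qr \<phi> N x \<bullet> Qr \<phi> N y)" for x y
    using Xc_inner_Pr[OF sa(2)[OF Pr_in_Xc], of x y] Xs_inner_Qr[OF Qr_in_Xs, of N x y]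
    by (simp add: lyapunov_operator_def inner_add_left)
  show "lyapunov_operator N Pim \<eta> x \<bullet> y = x \<bullet> lyapunov_operator N Pim \<eta> y"
    using eq[of x y] eq[of y x] sa(3)[OF Pr_in_Xc Pr_in_Xc, of x y] by (simp add: inner_commute)
  show "lyapunov_operator N Pim \<eta> x \<bullet> x = Pim (Pr \<phi> N x) \<bullet> Pr \<phi> N x + \<eta> * (norm (Qr \<phi> N x))\<^sup>2"
    using eq[of x x] by (simp add: power2_norm_eq_inner)
  show "lyapunov_operator N Pim \<eta> x \<in> Xc \<phi> n" if "N \<le> n" "x \<in> Xc \<phi> n"
    unfolding lyapunov_operator_def Qr_def
    using Xc_mono[OF that(1)] that(2) sa(2)[OF Pr_in_Xc, of x] Pr_in_Xc[of N x] subspace_Xc[of n]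
    by (intro subspace_add subspace_scale subspace_diff) auto
qed

text \<open>Split \<open>x\<close> into \<open>c\<close> and \<open>q\<close>. As \<open>A\<close>
  is symmetric and maps \<open>Xc \<phi> N\<close> into itself, its mixed terms vanish; the critical
  inequality governs \<open>c\<close>, the eigenvalue gap governs \<open>q\<close>, and the mixed
  terms of \<open>L\<close> cost the coupling norms. What remains is \<open>margin\<close> at the
  scalars \<open>a\<close> and \<open>b\<close>.\<close>

lemma lyapunov_dissipation:
  fixes L :: "'a \<Rightarrow>\<^sub>L 'a"
  assumes Pim: "posdef_on (Xc \<phi> N) Pim" and crit: "critical_inequality A \<phi> L dm dp N Pim \<mu>"
    and dm: "0 < dm" and \<delta>: "\<delta> \<in> {dm..dp}" and \<eta>: "0 < \<eta>" and n: "N \<le> n" and x: "x \<in> Xc \<phi> n"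
    and margin: "\<And>a b. - \<mu> * a\<^sup>2 - \<eta> * mu_s \<phi> lam L dm N * b\<^sup>2
       + (gamma_cs \<phi> L N Pim + \<eta> * gamma_sc \<phi> L N Pim) * (a * b) \<le> - w * (a\<^sup>2 + \<eta> * b\<^sup>2)"
  shows "lyapunov_operator N Pim \<eta> x \<bullet> (- (\<delta> *\<^sub>R A x) - L x) \<le> - w * (lyapunov_operator N Pim \<eta> x \<bullet> x)"
proof -
  let ?S = "Xc \<phi> N"
  let ?R = "sqrt_on ?S Pim"
  define c q a b where "c = Pr \<phi> N x" and "q = Qr \<phi> N x" and "a = norm (?R c)" and "b = norm q"
  note sa = selfadj_onD[OF posdef_onD(1)[OF Pim]]
  note R = posdef_on_Xc(2)[OF Pim]
  note saR = selfadj_onD[OF posdef_onD(1)[OF R]]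
  have c: "c \<in> ?S" by (simp add: c_def Pr_in_Xc)
  have Pc: "Pim c \<in> ?S" by (rule sa(2)[OF c])
  have q: "q \<in> Xs \<phi> N" by (simp add: q_def Qr_in_Xs)
  have cn: "c \<in> Xc \<phi> n" using c Xc_mono[OF n] by blast
  have xcq: "x = c + q" by (simp add: c_def q_def Qr_def)
  have qn: "q \<in> Xc \<phi> n" using subspace_diff[OF subspace_Xc x cn] by (simp add: q_def c_def Qr_def)
  have cD: "c \<in> D" and qD: "q \<in> D" using Xc_in_D cn qn by blast+
  have Ax: "A x = A c + A q" unfolding xcq using linear_on_subD(2)[OF linear_A] cD qD by blast
  have Lx: "L x = L c + L q" by (simp add: xcq blinfun.add_right)
  have a2: "a\<^sup>2 = Pim c \<bullet> c" unfolding a_def by (rule norm_sqrt_on(1)[OF Pim c])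
  have t1: "Pim c \<bullet> (- (\<delta> *\<^sub>R A c) - L c) \<le> - \<mu> * a\<^sup>2"
  proof -
    have "Pim c \<bullet> (- (\<delta> *\<^sub>R A c) - L c) = Pim c \<bullet> Gcc A \<phi> L N \<delta> c"
      using Xc_inner_Pr[OF Pc, of "L c"] c by (simp add: Gcc_def Pr_Xc inner_diff_right)
    then show ?thesis using critical_inequality_inner[OF Pim crit \<delta> c] a2 by simp
  qed
  have t2: "Pim c \<bullet> A q = 0"
    using A_symmetric[OF qD Xc_in_D[OF Pc]] Xc_Xs_inner[OF A_in_Xc[OF Pc] q] by (simp add: inner_commute)
  have t3: "- (Pim c \<bullet> L q) \<le> gamma_cs \<phi> L N Pim * (a * b)"
  proof -
    have "Pim c \<bullet> L q = ?R (?R c) \<bullet> Pr \<phi> N (L q)"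
      using Xc_inner_Pr[OF Pc, of "L q"] posdef_on_Xc(3)[OF Pim c] by simp
    also have "\<dots> = ?R c \<bullet> ?R (Pr \<phi> N (L q))" by (rule saR(3)[OF saR(2)[OF c] Pr_in_Xc])
    finally have "- (Pim c \<bullet> L q) = (- ?R c) \<bullet> ?R (Pr \<phi> N (L q))" by simp
    also have "\<dots> \<le> norm (- ?R c) * norm (?R (Pr \<phi> N (L q)))" by (rule norm_cauchy_schwarz)
    also have "\<dots> \<le> a * (gamma_cs \<phi> L N Pim * b)"
      unfolding a_def b_def norm_minus_cancel by (intro mult_left_mono gamma_cs_bounds(3)[OF Pim q]) auto
    finally show ?thesis by (simp add: mult_ac)
  qed
  have t4: "q \<bullet> A c = 0"
    using Xc_Xs_inner[OF A_in_Xc[OF c] q] by (simp add: inner_commute)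
  have t5: "- (\<delta> * (q \<bullet> A q)) - q \<bullet> L q \<le> - (mu_s \<phi> lam L dm N * b\<^sup>2)"
  proof -
    have low: "lam (N + 1) * b\<^sup>2 \<le> q \<bullet> A q"
      using A_lower_bound[OF qn q] by (simp add: b_def inner_commute)
    \<comment> \<open>Nonnegativity lets the smallest value \<open>dm\<close> stand in for every
      \<open>\<delta>\<close>, which makes the estimate uniform over trajectories.\<close>
    have "0 \<le> lam (N + 1) * b\<^sup>2" using lam_pos[of "N + 1"] by simp
    then have "dm * (lam (N + 1) * b\<^sup>2) \<le> \<delta> * (lam (N + 1) * b\<^sup>2)"
      using \<delta> by (intro mult_right_mono) auto
    also have "\<dots> \<le> \<delta> * (q \<bullet> A q)" using low \<delta> dm by (intro mult_left_mono) auto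
    finally have "dm * lam (N + 1) * b\<^sup>2 \<le> \<delta> * (q \<bullet> A q)" by (simp add: mult.assoc)
    moreover have "- (q \<bullet> L q) \<le> ell_s \<phi> L N * b\<^sup>2"
      using ell_s_bounds(2)[OF q, of L] by (simp add: b_def inner_commute)
    ultimately show ?thesis by (simp add: mu_s_def left_diff_distrib)
  qed
  have t6: "- (q \<bullet> L c) \<le> gamma_sc \<phi> L N Pim * (a * b)"
  proof -
    have "- (q \<bullet> L c) = (- q) \<bullet> Qr \<phi> N (L c)" using Xs_inner_Qr[OF q, of "L c"] by simp
    also have "\<dots> \<le> norm (- q) * norm (Qr \<phi> N (L c))" by (rule norm_cauchy_schwarz)
    also have "\<dots> \<le> b * (gamma_sc \<phi> L N Pim * a)"
      unfolding a_def b_def norm_minus_cancel by (intro mult_left_mono gamma_sc_bounds(3)[OF Pim c]) auto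
    finally show ?thesis by (simp add: mult_ac)
  qed
  have "lyapunov_operator N Pim \<eta> x \<bullet> (- (\<delta> *\<^sub>R A x) - L x)
    = Pim c \<bullet> (- (\<delta> *\<^sub>R A c) - L c) - \<delta> * (Pim c \<bullet> A q) - Pim c \<bullet> L q
      + \<eta> * (- \<delta> * (q \<bullet> A c) + (- (\<delta> * (q \<bullet> A q)) - q \<bullet> L q) - q \<bullet> L c)"
    unfolding lyapunov_operator_def c_def[symmetric] q_def[symmetric] Ax Lx
    by (simp add: inner_add_left inner_add_right inner_diff_right algebra_simps)
  also have "\<dots> \<le> - \<mu> * a\<^sup>2 + gamma_cs \<phi> L N Pim * (a * b)
      + \<eta> * (- (mu_s \<phi> lam L dm N * b\<^sup>2) + gamma_sc \<phi> L N Pim * (a * b))"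
  proof -
    have "\<eta> * (- \<delta> * (q \<bullet> A c) + (- (\<delta> * (q \<bullet> A q)) - q \<bullet> L q) - q \<bullet> L c)
       \<le> \<eta> * (- (mu_s \<phi> lam L dm N * b\<^sup>2) + gamma_sc \<phi> L N Pim * (a * b))"
      using t4 t5 t6 \<eta> by (intro mult_left_mono) auto
    then show ?thesis using t1 t2 t3 by simp
  qed
  also have "\<dots> \<le> - w * (a\<^sup>2 + \<eta> * b\<^sup>2)"
    using margin[of a b] by (simp add: algebra_simps)
  also have "a\<^sup>2 + \<eta> * b\<^sup>2 = lyapunov_operator N Pim \<eta> x \<bullet> x"
    using lyapunov_operator_properties(4)[OF Pim, of \<eta> x] a2 by (simp add: b_def c_def q_def)
  finally show ?thesis .
qed

text \<open>\<open>V\<close> is equivalent to the squared norm, with constant \<open>K\<close> above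
  and \<open>I + 1 / \<eta>\<close> for the reverse bound. Decay of \<open>V\<close> at rate
  \<open>2 * w\<close> therefore gives decay of the norm at rate \<open>w\<close>, and no constant
  involves the trajectory.\<close>

lemma uniform_stability_certificate:
  fixes L :: "'a \<Rightarrow>\<^sub>L 'a"
  assumes dm: "0 < dm" and Pim: "posdef_on (Xc \<phi> N) Pim"
    and crit: "critical_inequality A \<phi> L dm dp N Pim \<mu>" and \<mu>: "0 < \<mu>"
    and \<mu>s: "0 < mu_s \<phi> lam L dm N" and \<eta>: "0 < \<eta>"
    and gap: "(gamma_cs \<phi> L N Pim + \<eta> * gamma_sc \<phi> L N Pim)\<^sup>2 < 4 * \<eta> * \<mu> * mu_s \<phi> lam L dm N"
  shows "uniformly_exp_stable D A \<phi> lam L dm dp"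
proof -
  obtain w where w: "0 < w" and margin: "\<And>a b. - \<mu> * a\<^sup>2 - \<eta> * mu_s \<phi> lam L dm N * b\<^sup>2
       + (gamma_cs \<phi> L N Pim + \<eta> * gamma_sc \<phi> L N Pim) * (a * b) \<le> - w * (a\<^sup>2 + \<eta> * b\<^sup>2)"
    using quadratic_form_margin[OF \<mu> \<mu>s \<eta> gap] by blast
  let ?T = "lyapunov_operator N Pim \<eta>"
  note T = lyapunov_operator_properties[OF Pim]
  obtain K where K: "K > 0" "\<And>x. norm (?T x) \<le> norm x * K"
    using bounded_linear.pos_bounded[OF T(1)[of \<eta>]] by blast
  define I where "I = opnorm_on (Xc \<phi> N) (inv_into (Xc \<phi> N) Pim)"
  have I0: "0 \<le> I"
  proof -
    obtain B where "0 \<le> B" "\<And>x. x \<in> Xc \<phi> N \<Longrightarrow> norm (inv_into (Xc \<phi> N) Pim x) \<le> B * norm x"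
      using linear_on_Xc_bounded[OF linear_on_inv_into(1)[OF Pim]] by blast
    then show ?thesis unfolding I_def
      using subspace_0[OF subspace_Xc] by (intro opnorm_on_nonneg bdd_above_opnorm_on) auto
  qed
  have upper: "?T x \<bullet> x \<le> K * (norm x)\<^sup>2" for x
  proof -
    have "?T x \<bullet> x \<le> norm (?T x) * norm x" by (rule norm_cauchy_schwarz)
    also have "\<dots> \<le> (norm x * K) * norm x" by (intro mult_right_mono K(2)) simp
    finally show ?thesis by (simp add: power2_eq_square mult_ac)
  qed
  have lower: "(norm x)\<^sup>2 \<le> (I + 1 / \<eta>) * (?T x \<bullet> x)" for x
  proof -
    define c where "c = Pr \<phi> N x"
    define a where "a = norm (sqrt_on (Xc \<phi> N) Pim c)"
    define b where "b = norm (Qr \<phi> N x)"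
    have c: "c \<in> Xc \<phi> N" by (simp add: c_def Pr_in_Xc)
    have R: "posdef_on (Xc \<phi> N) (sqrt_on (Xc \<phi> N) Pim)" by (rule posdef_on_Xc(2)[OF Pim])
    have Rc: "sqrt_on (Xc \<phi> N) Pim c \<in> Xc \<phi> N" using selfadj_onD(2)[OF posdef_onD(1)[OF R] c] .
    have "norm c \<le> sqrt I * a"
      using norm_inv_sqrt_on[OF Pim Rc] linear_on_inv_into(4)[OF R c] by (simp add: I_def a_def)
    then have "(norm c)\<^sup>2 \<le> (sqrt I * a)\<^sup>2" by (intro power_mono) auto
    then have "(norm c)\<^sup>2 \<le> I * a\<^sup>2" using I0 by (simp add: power_mult_distrib)
    then have "(norm x)\<^sup>2 \<le> I * a\<^sup>2 + b\<^sup>2"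
      using norm_sq_Pr_Qr[of x N] by (simp add: b_def c_def)
    \<comment> \<open>Multiplying out leaves the nonnegative surplus
      \<open>I * \<eta> * b\<^sup>2 + a\<^sup>2 / \<eta>\<close>.\<close>
    also have "\<dots> \<le> (I + 1 / \<eta>) * (a\<^sup>2 + \<eta> * b\<^sup>2)"
      using I0 \<eta> by (simp add: algebra_simps)
    also have "a\<^sup>2 + \<eta> * b\<^sup>2 = ?T x \<bullet> x"
      using T(4)[of \<eta> x] norm_sqrt_on(1)[OF Pim c] by (simp add: a_def b_def c_def)
    finally show ?thesis .
  qed
  \<comment> \<open>The root comes from passing from squared norms to norms; the maximum secures
    \<open>1 \<le> M\<close>, which also settles \<open>s = t = t0\<close>.\<close>
  define M where "M = max 1 (sqrt ((I + 1 / \<eta>) * K))"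
  have M1: "1 \<le> M" by (simp add: M_def)
  have IK: "0 \<le> (I + 1 / \<eta>) * K" using I0 \<eta> K by simp
  have M2: "(I + 1 / \<eta>) * K \<le> M\<^sup>2"
  proof -
    have "(sqrt ((I + 1 / \<eta>) * K))\<^sup>2 \<le> M\<^sup>2" using IK by (intro power_mono) (auto simp: M_def)
    then show ?thesis using IK by simp
  qed
  show ?thesis
    unfolding uniformly_exp_stable_def
  proof (rule exI[of _ M], rule conjI[OF M1], rule exI[of _ w], intro conjI[OF w] allI impI)
    fix d t0 z s t
    assume adm: "admissible dm dp d" and t0: "0 \<le> t0"
      and sol: "strong_solution D A L d t0 z \<or> mild_solution \<phi> lam L d t0 z"
      and st: "t0 \<le> s \<and> s \<le> t"
    have cs: "coefficient_solution \<phi> lam L d t0 z"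
      using sol strong_imp_coefficient_solution mild_imp_coefficient_solution[OF adm dm t0] by blast
    have dec: "norm (z t) \<le> M * exp (- w * (t - a)) * norm (z a)" if a: "t0 < a" "a \<le> t" for a
    proof -
      have "?T (z t) \<bullet> z t \<le> exp (- 2 * w * (t - a)) * (?T (z a) \<bullet> z a)"
      proof (rule lyapunov_decay[OF cs a w _ T(1,2,3)])
        show "d r \<in> {dm..dp}" if "t0 < r" for r using adm t0 that by (simp add: admissible_def)
        show "?T x \<bullet> (- (\<delta> *\<^sub>R A x) - L x) \<le> - w * (?T x \<bullet> x)"
          if "N \<le> n" "x \<in> Xc \<phi> n" "\<delta> \<in> {dm..dp}" for n x \<delta>
          using that by (intro lyapunov_dissipation[OF Pim crit dm _ \<eta> _ _ margin]) auto
      qed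
      then have "(I + 1 / \<eta>) * (?T (z t) \<bullet> z t) \<le> (I + 1 / \<eta>) * (exp (- 2 * w * (t - a)) * (K * (norm (z a))\<^sup>2))"
        using I0 \<eta> upper[of "z a"] by (intro mult_left_mono) (auto intro: order_trans mult_left_mono)
      then have "(norm (z t))\<^sup>2 \<le> ((I + 1 / \<eta>) * K) * (exp (- 2 * w * (t - a)) * (norm (z a))\<^sup>2)"
        using lower[of "z t"] by (simp add: mult_ac)
      also have "\<dots> \<le> M\<^sup>2 * (exp (- 2 * w * (t - a)) * (norm (z a))\<^sup>2)"
        by (intro mult_right_mono M2) simp
      also have "exp (- 2 * w * (t - a)) = (exp (- w * (t - a)))\<^sup>2"
        by (simp add: power2_eq_square exp_add[symmetric])
      also have "M\<^sup>2 * ((exp (- w * (t - a)))\<^sup>2 * (norm (z a))\<^sup>2) = (M * exp (- w * (t - a)) * norm (z a))\<^sup>2"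
        by (simp add: power_mult_distrib mult.assoc)
      finally show ?thesis by (rule power2_le_imp_le) (simp add: M_def)
    qed
    show "norm (z t) \<le> M * exp (- w * (t - s)) * norm (z s)"
    proof -
      \<comment> \<open>\<open>dec\<close> covers only starting times after \<open>t0\<close>. For
        \<open>s = t0 < t\<close> its inequality passes to the limit, both sides being continuous in
        the starting time.\<close>
      consider "t0 < s" | "s = t0" "t = t0" | "s = t0" "t0 < t" using st by linarith
      then show ?thesis
      proof cases
        case 2
        then show ?thesis using mult_right_mono[of 1 M "norm (z t0)"] by (simp add: M_def)
      next
        case 3
        have cl: "closure {t0<..<t} = {t0..t}" using 3 by (intro closure_greaterThanLessThan)
        have "continuous_on {t0..t} z"
          using cs by (auto simp: coefficient_solution_def elim: continuous_on_subset)
        then have cont: "continuous_on (closure {t0<..<t}) (\<lambda>a. M * exp (- w * (t - a)) * norm (z a))"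
          unfolding cl by (intro continuous_intros)
        have "t0 \<in> closure {t0<..<t}" using cl 3 by auto
        then show ?thesis
          unfolding 3(1) by (rule continuous_ge_on_closure[OF cont]) (use dec in auto)
      qed (use dec st in auto)
    qed
  qed
qed

end

section \<open>The gap condition for large truncation order\<close>

theorem theorem9:
  fixes D :: "'a::{real_inner, complete_space} set"
    and A0 :: "'a \<Rightarrow> 'a"
    and \<phi> :: "nat \<Rightarrow> 'a" and lam :: "nat \<Rightarrow> real"
    and A1 L :: "'a \<Rightarrow>\<^sub>L 'a"
    and B :: "(real ^ 'm::finite) \<Rightarrow>\<^sub>L 'a" and C :: "'a \<Rightarrow>\<^sub>L (real ^ 'p::finite)"
    and K0 K1 :: "(real ^ 'p::finite) \<Rightarrow>\<^sub>L (real ^ 'm::finite)"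
    and dm dp :: real
    and Pim :: "nat \<Rightarrow> 'a \<Rightarrow> 'a" and \<mu>c :: "nat \<Rightarrow> real" and N0 :: nat
  assumes d_bounds: "0 < dm" "dm \<le> dp"
    and A0: "selfadj_unbounded D A0" "strictly_positive D A0" "compact_resolvent D A0"
    and basis: "eigenbasis D A0 \<phi> lam"
    and L_def: "L = - (B o\<^sub>L K1 o\<^sub>L C)"
    and compatibility: "A1 = B o\<^sub>L K0 o\<^sub>L C"
    and Pi: "\<forall>N\<ge>1. posdef_on (Xc \<phi> N) (Pim N)"
    and mu_c: "\<forall>N\<ge>1. 0 < \<mu>c N"
    and critical: "\<forall>N\<ge>1. critical_inequality A0 \<phi> L dm dp N (Pim N) (\<mu>c N)"
    and mu_s: "\<forall>N\<ge>1. 0 < mu_s \<phi> lam L dm N"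
    and N0: "1 \<le> N0"
    and inf_mu_c: "0 < (INF N\<in>{N0..}. \<mu>c N)"
    and sup_Pi: "bdd_above ((\<lambda>N. opnorm_on (Xc \<phi> N) (Pim N)) ` {N0..})"
    and sup_Pi_inv: "bdd_above ((\<lambda>N. opnorm_on (Xc \<phi> N) (inv_into (Xc \<phi> N) (Pim N))) ` {N0..})"
  shows "(\<exists>Nstar\<ge>1. \<forall>N\<ge>Nstar.
            0 < mu_s \<phi> lam L dm N \<and>
            posdef_on (Xc \<phi> N) (Pim N) \<and> 0 < \<mu>c N \<and>
            critical_inequality A0 \<phi> L dm dp N (Pim N) (\<mu>c N) \<and>
            (\<exists>\<eta>>0. 4 * \<eta> * \<mu>c N * mu_s \<phi> lam L dm N
                     > (gamma_cs \<phi> L N (Pim N) + \<eta> * gamma_sc \<phi> L N (Pim N))\<^sup>2)) \<and>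
         uniformly_exp_stable D A0 \<phi> lam L dm dp"
proof -
  have onb: "orthonormal_basis \<phi>" using basis by (simp add: eigenbasis_def)
  interpret diagonal_operator \<phi> D A0 lam
    using onb basis A0(1) by unfold_locales
  obtain B1 where B1: "\<And>N. N0 \<le> N \<Longrightarrow> opnorm_on (Xc \<phi> N) (Pim N) \<le> B1"
    using sup_Pi unfolding bdd_above_def by auto
  obtain B2 where B2: "\<And>N. N0 \<le> N \<Longrightarrow> opnorm_on (Xc \<phi> N) (inv_into (Xc \<phi> N) (Pim N)) \<le> B2"
    using sup_Pi_inv unfolding bdd_above_def by auto
  define m where "m = (INF N\<in>{N0..}. \<mu>c N)"
  have m0: "0 < m" using inf_mu_c by (simp add: m_def)
  have bdd: "bdd_below (\<mu>c ` {N0..})"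
    using mu_c N0 by (intro bdd_belowI2[of _ 0]) (auto simp: less_imp_le)
  have m: "m \<le> \<mu>c N" if "N0 \<le> N" for N
    unfolding m_def using that by (intro cINF_lower[OF bdd]) auto
  \<comment> \<open>A bound for the sum of both coupling norms valid for all
    \<open>N \<ge> N0\<close>; the weights enter through their square roots.\<close>
  define g where "g = sqrt B1 * norm L + sqrt B2 * norm L"
  have g: "gamma_cs \<phi> L N (Pim N) + gamma_sc \<phi> L N (Pim N) \<le> g" if N: "N0 \<le> N" for N
  proof -
    have Pn: "posdef_on (Xc \<phi> N) (Pim N)" using Pi N N0 by auto
    have "gamma_cs \<phi> L N (Pim N) \<le> sqrt B1 * norm L"
      by (rule order_trans[OF gamma_cs_bounds(2)[OF Pn]]) (intro mult_right_mono real_sqrt_le_mono B1[OF N] norm_ge_zero)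
    moreover have "gamma_sc \<phi> L N (Pim N) \<le> sqrt B2 * norm L"
      by (rule order_trans[OF gamma_sc_bounds(2)[OF Pn]]) (intro mult_right_mono real_sqrt_le_mono B2[OF N] norm_ge_zero)
    ultimately show ?thesis by (simp add: g_def)
  qed
  have "filterlim lam at_top sequentially" using basis by (simp add: eigenbasis_def)
  \<comment> \<open>The threshold makes \<open>dm * lam (N + 1)\<close> exceed
    \<open>g\<^sup>2 / (4 * m)\<close> even after \<open>ell_s\<close>, at most
    \<open>norm L\<close>, is subtracted; the summand \<open>1\<close> makes this strict.\<close>
  then obtain N1 where N1: "\<And>n. N1 \<le> n \<Longrightarrow> (g\<^sup>2 / (4 * m) + 1 + norm L) / dm \<le> lam n"
    unfolding filterlim_at_top eventually_sequentially by meson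
  define Nstar where "Nstar = max N0 N1"
  have Nstar: "1 \<le> Nstar" using N0 by (simp add: Nstar_def)
  have cert: "0 < mu_s \<phi> lam L dm N \<and>
            posdef_on (Xc \<phi> N) (Pim N) \<and> 0 < \<mu>c N \<and>
            critical_inequality A0 \<phi> L dm dp N (Pim N) (\<mu>c N) \<and>
            (\<exists>\<eta>>0. 4 * \<eta> * \<mu>c N * mu_s \<phi> lam L dm N
                     > (gamma_cs \<phi> L N (Pim N) + \<eta> * gamma_sc \<phi> L N (Pim N))\<^sup>2)"
    if N: "Nstar \<le> N" for N
  proof -
    have N': "1 \<le> N" "N0 \<le> N" "N1 \<le> N + 1" using N N0 by (auto simp: Nstar_def)
    have Pn: "posdef_on (Xc \<phi> N) (Pim N)" using Pi N' by simp
    have "g\<^sup>2 / (4 * m) + 1 + norm L \<le> dm * lam (N + 1)"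
      using N1[OF N'(3)] d_bounds(1) by (simp add: divide_le_eq mult.commute)
    then have "g\<^sup>2 / (4 * m) < mu_s \<phi> lam L dm N"
      using ell_s_bounds(1)[of L N] by (simp add: mu_s_def)
    then have "g\<^sup>2 < 4 * m * mu_s \<phi> lam L dm N" using m0 by (simp add: divide_less_eq mult.commute)
    also have "\<dots> \<le> 4 * \<mu>c N * mu_s \<phi> lam L dm N"
      using m[OF N'(2)] mu_s N'(1) by (intro mult_right_mono) (auto simp: less_imp_le)
    finally have big: "g\<^sup>2 < 4 * \<mu>c N * mu_s \<phi> lam L dm N" .
    have "(gamma_cs \<phi> L N (Pim N) + gamma_sc \<phi> L N (Pim N))\<^sup>2 \<le> g\<^sup>2"
      using g[OF N'(2)] gamma_cs_bounds(1)[OF Pn, of L] gamma_sc_bounds(1)[OF Pn, of L]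
      by (intro power_mono) auto
    then have "(gamma_cs \<phi> L N (Pim N) + 1 * gamma_sc \<phi> L N (Pim N))\<^sup>2 < 4 * 1 * \<mu>c N * mu_s \<phi> lam L dm N"
      using big by simp
    then have "\<exists>\<eta>>0. 4 * \<eta> * \<mu>c N * mu_s \<phi> lam L dm N
                     > (gamma_cs \<phi> L N (Pim N) + \<eta> * gamma_sc \<phi> L N (Pim N))\<^sup>2"
      by (intro exI[of _ 1]) simp
    then show ?thesis using Pn mu_s mu_c critical N'(1) by blast
  qed
  \<comment> \<open>One truncation order suffices here: the certificate is applied at
    \<open>Nstar\<close> itself.\<close>
  have "uniformly_exp_stable D A0 \<phi> lam L dm dp"
    using cert[OF order_refl] uniform_stability_certificate[OF d_bounds(1)] by blast
  then show ?thesis using Nstar cert by blast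
qed

end
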